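(* Let $\mathcal{X}_1,\dots,\mathcal{X}_d$ be Polish spaces and, for each $1\le j\le d$, let $k_j:\mathcal{X}_j\times\mathcal{X}_j\to\mathbb{R}$ be a bounded, continuous, point-separating kernel with RKHS $\mathcal{H}_j$. Let $\gamma$ and $\eta$ be Borel probability measures on $\mathcal{X}_1\times\dots\times\mathcal{X}_d$. Then $$\gamma=\eta \quad\text{if and only if}\quad \kappa_{k_1,\dots,k_d}(\gamma)=\kappa_{k_1,\dots,k_d}(\eta),$$ i.e. $\kappa^{\mathbf{i}}_{k_1,\dots,k_d}(\gamma)=\kappa^{\mathbf{i}}_{k_1,\dots,k_d}(\eta)$ for all multi-indices $\mathbf{i}\in\mathbb{N}^d$ of degree at least $1$. Moreover, for every $\mathbf{i}\in\mathbb{N}^d$ with $m=\deg(\mathbf{i})\ge 1$, $$\big\|\kappa^{\mathbf{i}}_{k_1,\dots,k_d}(\gamma)-\kappa^{\mathbf{i}}_{k_1,\dots,k_d}(\eta)\big\|^2_{\mathcal{H}^{\otimes\mathbf{i}}}=\sum_{\pi,\tau\in P(m)}c_\pi c_\tau\Big[\mathbb{E}_{\gamma^{\mathbf{i}}_\pi\otimes\gamma^{\mathbf{i}}_\tau}k^{\otimes\mathbf{i}}(Z,Z')+\mathbb{E}_{\eta^{\mathbf{i}}_\pi\otimes\eta^{\mathbf{i}}_\tau}k^{\otimes\mathbf{i}}(Z,Z')-2\,\mathbb{E}_{\gamma^{\mathbf{i}}_\pi\otimes\eta^{\mathbf{i}}_\tau}k^{\otimes\mathbf{i}}(Z,Z')\Big],$$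 where in each expectation $(Z,Z')=((Z_1,\dots,Z_m),(Z'_1,\dots,Z'_m))$ is distributed according to the indicated product measure.
   Context: A kernel $k$ on $\mathcal{X}$ is point-separating if $x\mapsto k(x,\cdot)$ is injective; bounded means $\sup_{x,x'}k(x,x')<\infty$. For $\mathbf{i}=(i_1,\dots,i_d)\in\mathbb{N}^d$ (nonnegative integers) let $\deg(\mathbf{i})=i_1+\dots+i_d=m$, and for $1\le j\le m$ let $a(j)=l$ when $i_1+\dots+i_{l-1}<j\le i_1+\dots+i_l$. $P(m)$ is the set of partitions of $\{1,\dots,m\}$ into nonempty disjoint blocks; for $\pi\in P(m)$, $|\pi|$ is its number of blocks and $c_\pi=(-1)^{|\pi|-1}(|\pi|-1)!$. Diagonal measure: for $(X_1,\dots,X_d)\sim\gamma$, $\gamma^{\mathbf{i}}$ is the law on $\mathcal{X}_{a(1)}\times\dots\times\mathcal{X}_{a(m)}$ of $(X_1,\dots,X_1,X_2,\dots,X_2,\dots,X_d,\dots,X_d)$ with $X_l$ repeated $i_l$ times. Partition measure: for $\pi=\{\pi_1,\dots,\pi_b\}\in P(m)$, $\gamma^{\mathbf{i}}_\pi$ is the law of a random vector $(Z_1,\dots,Z_m)$ such that the subvectors $(Z_j)_{j\in\pi_1},\dots,(Z_j)_{j\in\pi_b}$ are independent and each $(Z_j)_{j\in\pi_l}$ has the law of $(W_j)_{j\in\pi_l}$ for $W\sim\gamma^{\mathbf{i}}$ (i.e. the product of the block marginals of $\gamma^{\mathbf{i}}$). Define the kernel $k^{\otimes\mathbf{i}}(z,z')=\prod_{j=1}^m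 k_{a(j)}(z_j,z'_j)$ on $\mathcal{X}_{a(1)}\times\dots\times\mathcal{X}_{a(m)}$, whose RKHS is $\mathcal{H}^{\otimes\mathbf{i}}=\mathcal{H}_1^{\otimes i_1}\otimes\dots\otimes\mathcal{H}_d^{\otimes i_d}$ (Hilbert tensor product). The kernelized cumulant of degree $\mathbf{i}$ ($m\ge1$) is $\kappa^{\mathbf{i}}_{k_1,\dots,k_d}(\gamma)=\sum_{\pi\in P(m)}c_\pi\,\mathbb{E}_{Z\sim\gamma^{\mathbf{i}}_\pi}\big[k^{\otimes\mathbf{i}}(Z,\cdot)\big]\in\mathcal{H}^{\otimes\mathbf{i}}$ (Bochner integral), and $\kappa_{k_1,\dots,k_d}(\gamma)=(\kappa^{\mathbf{i}}_{k_1,\dots,k_d}(\gamma))_{\mathbf{i}}$; the degree-zero component is the same constant for every measure. *)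

theory Defs
  imports "HOL-Probability.Probability" "HOL-Library.Disjoint_Sets"
begin

definition Polish :: "'a topology \<Rightarrow> bool" where
  "Polish X \<longleftrightarrow> completely_metrizable_space X \<and> separable_space X"

definition borel_of :: "'a topology \<Rightarrow> 'a measure" where
  "borel_of X = sigma (topspace X) {U. openin X U}"

definition pd_kernel :: "'a set \<Rightarrow> ('a \<Rightarrow> 'a \<Rightarrow> real) \<Rightarrow> bool" where
  "pd_kernel S K \<longleftrightarrow> (\<forall>x\<in>S. \<forall>y\<in>S. K x y = K y x) \<and>
     (\<forall>(n::nat) (c::nat \<Rightarrow> real) (x::nat \<Rightarrow> 'a). (\<forall>j<n. x j \<in> S) \<longrightarrow>
        0 \<le> (\<Sum>j<n. \<Sum>l<n. c j * c l * K (x j) (x l)))"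

definition bounded_kernel :: "'a set \<Rightarrow> ('a \<Rightarrow> 'a \<Rightarrow> real) \<Rightarrow> bool" where
  "bounded_kernel S K \<longleftrightarrow> (\<exists>B. \<forall>x\<in>S. \<forall>y\<in>S. \<bar>K x y\<bar> \<le> B)"

definition point_separating :: "'a set \<Rightarrow> ('a \<Rightarrow> 'a \<Rightarrow> real) \<Rightarrow> bool" where
  "point_separating S K \<longleftrightarrow> inj_on (\<lambda>x. \<lambda>y\<in>S. K x y) S"

section \<open>RKHS (Moore--Aronszajn completion, elements realised as functions on S)\<close>

definition pre_eval :: "('a \<Rightarrow> 'a \<Rightarrow> real) \<Rightarrow> (real \<times> 'a) list \<Rightarrow> 'a \<Rightarrow> real" where
  "pre_eval K r z = (\<Sum>(c,x)\<leftarrow>r. c * K x z)"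

definition pre_nsq :: "('a \<Rightarrow> 'a \<Rightarrow> real) \<Rightarrow> (real \<times> 'a) list \<Rightarrow> real" where
  "pre_nsq K r = (\<Sum>(c,x)\<leftarrow>r. \<Sum>(c',x')\<leftarrow>r. c * c' * K x x')"

definition pre_diff :: "(real \<times> 'a) list \<Rightarrow> (real \<times> 'a) list \<Rightarrow> (real \<times> 'a) list" where
  "pre_diff r s = r @ map (\<lambda>(c,x). (- c, x)) s"

definition rkhs_approx :: "'a set \<Rightarrow> ('a \<Rightarrow> 'a \<Rightarrow> real) \<Rightarrow> ('a \<Rightarrow> real) \<Rightarrow> (nat \<Rightarrow> (real \<times> 'a) list) \<Rightarrow> bool" where
  "rkhs_approx S K f r \<longleftrightarrow> (\<forall>n. snd ` set (r n) \<subseteq> S) \<and>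
     (\<forall>e>0. \<exists>N. \<forall>n\<ge>N. \<forall>n'\<ge>N. pre_nsq K (pre_diff (r n) (r n')) < e) \<and>
     (\<forall>z\<in>S. (\<lambda>n. pre_eval K (r n) z) \<longlonglongrightarrow> f z)"

definition in_rkhs :: "'a set \<Rightarrow> ('a \<Rightarrow> 'a \<Rightarrow> real) \<Rightarrow> ('a \<Rightarrow> real) \<Rightarrow> bool" where
  "in_rkhs S K f \<longleftrightarrow> (\<exists>r. rkhs_approx S K f r)"

definition rkhs_norm_sq :: "'a set \<Rightarrow> ('a \<Rightarrow> 'a \<Rightarrow> real) \<Rightarrow> ('a \<Rightarrow> real) \<Rightarrow> real" where
  "rkhs_norm_sq S K f = lim (\<lambda>n. pre_nsq K ((SOME r. rkhs_approx S K f r) n))"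

text \<open>Multi-index i in N^d: i j = 0 for j \<ge> d. Degree m. Components are 0-based.\<close>
definition deg :: "nat \<Rightarrow> (nat \<Rightarrow> nat) \<Rightarrow> nat" where
  "deg d i = (\<Sum>l<d. i l)"

definition aidx :: "(nat \<Rightarrow> nat) \<Rightarrow> nat \<Rightarrow> nat" where
  "aidx i j = (LEAST l. j < (\<Sum>l'<Suc l. i l'))"

definition joint_space :: "nat \<Rightarrow> (nat \<Rightarrow> 'a topology) \<Rightarrow> (nat \<Rightarrow> 'a) measure" where
  "joint_space d X = PiM {..<d} (\<lambda>j. borel_of (X j))"

text \<open>The space X_{a(1)} x ... x X_{a(m)} with its Borel (= product Borel) sigma algebra.\<close>
definition tens_space :: "nat \<Rightarrow> (nat \<Rightarrow> 'a topology) \<Rightarrow> (nat \<Rightarrow> nat) \<Rightarrow> (nat \<Rightarrow> 'a) measure" where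
  "tens_space d X i = PiM {..<deg d i} (\<lambda>j. borel_of (X (aidx i j)))"

definition tens_carrier :: "nat \<Rightarrow> (nat \<Rightarrow> 'a topology) \<Rightarrow> (nat \<Rightarrow> nat) \<Rightarrow> (nat \<Rightarrow> 'a) set" where
  "tens_carrier d X i = PiE {..<deg d i} (\<lambda>j. topspace (X (aidx i j)))"

definition diag_measure :: "nat \<Rightarrow> (nat \<Rightarrow> 'a topology) \<Rightarrow> (nat \<Rightarrow> nat) \<Rightarrow> (nat \<Rightarrow> 'a) measure \<Rightarrow> (nat \<Rightarrow> 'a) measure" where
  "diag_measure d X i \<gamma> = distr \<gamma> (tens_space d X i) (\<lambda>x. \<lambda>j\<in>{..<deg d i}. x (aidx i j))"

definition block_marginal :: "nat \<Rightarrow> (nat \<Rightarrow> 'a topology) \<Rightarrow> (nat \<Rightarrow> nat) \<Rightarrow> (nat \<Rightarrow> 'a) measure \<Rightarrow> nat set \<Rightarrow> (nat \<Rightarrow> 'a) measure" where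
  "block_marginal d X i \<gamma> B = distr (diag_measure d X i \<gamma>) (PiM B (\<lambda>j. borel_of (X (aidx i j)))) (\<lambda>z. restrict z B)"

definition partition_measure :: "nat \<Rightarrow> (nat \<Rightarrow> 'a topology) \<Rightarrow> (nat \<Rightarrow> nat) \<Rightarrow> (nat \<Rightarrow> 'a) measure \<Rightarrow> nat set set \<Rightarrow> (nat \<Rightarrow> 'a) measure" where
  "partition_measure d X i \<gamma> \<pi> =
     distr (PiM \<pi> (\<lambda>B. block_marginal d X i \<gamma> B)) (tens_space d X i)
       (\<lambda>w. \<lambda>j\<in>{..<deg d i}. w (THE B. B \<in> \<pi> \<and> j \<in> B) j)"

definition partitions :: "nat \<Rightarrow> nat set set set" where
  "partitions m = {\<pi>. partition_on {..<m} \<pi>}"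

definition cpi :: "nat set set \<Rightarrow> real" where
  "cpi \<pi> = (-1) ^ (card \<pi> - 1) * fact (card \<pi> - 1)"

definition ktens :: "nat \<Rightarrow> (nat \<Rightarrow> 'a \<Rightarrow> 'a \<Rightarrow> real) \<Rightarrow> (nat \<Rightarrow> nat) \<Rightarrow> (nat \<Rightarrow> 'a) \<Rightarrow> (nat \<Rightarrow> 'a) \<Rightarrow> real" where
  "ktens d k i z z' = (\<Prod>j<deg d i. k (aidx i j) (z j) (z' j))"

text \<open>Kernelized cumulant of degree i, as an element of the RKHS of k^{\<otimes>i}, i.e. as a function:
  the Bochner integral E[k^{\<otimes>i}(Z,.)] evaluated at z equals E[k^{\<otimes>i}(Z,z)].\<close>
definition kcumulant :: "nat \<Rightarrow> (nat \<Rightarrow> 'a topology) \<Rightarrow> (nat \<Rightarrow> 'a \<Rightarrow> 'a \<Rightarrow> real) \<Rightarrow> (nat \<Rightarrow> nat) \<Rightarrow> (nat \<Rightarrow> 'a) measure \<Rightarrow> (nat \<Rightarrow> 'a) \<Rightarrow> real" where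
  "kcumulant d X k i \<gamma> z =
     (\<Sum>\<pi>\<in>partitions (deg d i). cpi \<pi> * (\<integral>Z. ktens d k i Z z \<partial>partition_measure d X i \<gamma> \<pi>))"

definition cross_term :: "nat \<Rightarrow> (nat \<Rightarrow> 'a topology) \<Rightarrow> (nat \<Rightarrow> 'a \<Rightarrow> 'a \<Rightarrow> real) \<Rightarrow> (nat \<Rightarrow> nat) \<Rightarrow> (nat \<Rightarrow> 'a) measure \<Rightarrow> nat set set \<Rightarrow> (nat \<Rightarrow> 'a) measure \<Rightarrow> nat set set \<Rightarrow> real" where
  "cross_term d X k i \<gamma> \<pi> \<eta> \<tau> =
     (\<integral>p. ktens d k i (fst p) (snd p) \<partial>(pair_measure (partition_measure d X i \<gamma> \<pi>) (partition_measure d X i \<eta> \<tau>)))"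

end

theory Submission
  imports Defs
begin

text \<open>
  \<^emph>\<open>Norm formula.\<close> Extend the kernel to probability measures by \<open>\<langle>\<mu>, \<nu>\<rangle> = \<integral>\<integral> K d\<mu> d\<nu>\<close>. In a formal linear
  combination of measures, a term \<open>t \<mu>\<close> can be replaced by \<open>N\<close> point masses of weight \<open>t / N\<close>, chosen one
  after another, at the cost of increasing the square norm by at most \<open>2 B t\<^sup>2 / N\<close>. Hence the extended
  form is positive semidefinite, and point combinations approximate mean embeddings in norm.

  \<^emph>\<open>Injectivity.\<close> By induction on the degree, equal cumulants give equal moments of the functions
  \<open>x \<mapsto> k\<^sub>l(x\<^sub>l, z)\<close>. These are bounded, so the measures agree on the sigma-algebra generated by
  these functions. Since they separate points, this sigma-algebra contains all cylinders over compact
  sets, and by tightness this suffices.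
\<close>

section \<open>Positive semidefinite forms on formal linear combinations\<close>

text \<open>\<open>rkhs_norm_sq\<close> takes a limit along an approximating sequence picked by
  \<open>SOME\<close>, about which only \<open>rkhs_approx\<close> is known. So one sequence has to
  be exhibited for a cumulant difference, and every other one has to be shown to give the same
  limit. The form on measures serves both ends without any completion: a cumulant difference is
  represented there by a finite signed combination of probability measures, which acts as the limit
  in norm. Convergence arguments in this form rest on Cauchy-Schwarz, so its positivity has to come
  first. In the bound for the replacement, the \<open>N\<close> points cost at most
  \<open>2 B (t / N)\<^sup>2\<close> each. Point separation is weaker than injectivity of the mean
  embedding, so degree-one data alone would not do. Multi-indices with repeated entries supply
  products of sections in the same coordinate, with independently chosen evaluation points; this is
  what makes the moments run over a class closed under products.\<close>

definition pre_ip :: "('a \<Rightarrow> 'a \<Rightarrow> real) \<Rightarrow> (real \<times> 'a) list \<Rightarrow> (real \<times> 'a) list \<Rightarrow> real" where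
  "pre_ip K r s = (\<Sum>(c,x)\<leftarrow>r. \<Sum>(c',x')\<leftarrow>s. c * c' * K x x')"

definition pre_scale :: "real \<Rightarrow> (real \<times> 'a) list \<Rightarrow> (real \<times> 'a) list" where
  "pre_scale t r = map (\<lambda>(c,x). (t * c, x)) r"

lemma pre_nsq_eq_ip: "pre_nsq K r = pre_ip K r r"
  by (simp add: pre_nsq_def pre_ip_def)

lemma pre_ip_Nil [simp]: "pre_ip K [] s = 0" "pre_ip K r [] = 0"
  by (induction r) (auto simp: pre_ip_def)

lemma pre_ip_append [simp]:
  "pre_ip K (r @ r') s = pre_ip K r s + pre_ip K r' s"
  "pre_ip K r (s @ s') = pre_ip K r s + pre_ip K r s'"
  by (induction r) (auto simp: pre_ip_def)

lemma pre_ip_Cons: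
  "pre_ip K (p # r) s = pre_ip K [p] s + pre_ip K r s"
  "pre_ip K r (p # s) = pre_ip K r [p] + pre_ip K r s"
  using pre_ip_append(1)[of K "[p]" r s] pre_ip_append(2)[of K r "[p]" s] by auto

lemma pre_ip_single [simp]: "pre_ip K [(c,x)] [(c',x')] = c * c' * K x x'"
  by (simp add: pre_ip_def)

lemma pre_ip_scale [simp]:
  "pre_ip K (pre_scale t r) s = t * pre_ip K r s"
  "pre_ip K r (pre_scale t s) = t * pre_ip K r s"
proof -
  have 1: "pre_ip K [p] (pre_scale t s) = t * pre_ip K [p] s" for p s
    by (cases p, induction s) (auto simp: pre_ip_def pre_scale_def algebra_simps)
  show "pre_ip K r (pre_scale t s) = t * pre_ip K r s"
  proof (induction r)
    case (Cons p r)
    show ?case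
      using 1 Cons by (subst (1 2) pre_ip_Cons(1)) (simp add: algebra_simps)
  qed simp
  have 2: "pre_ip K (pre_scale t r) [p] = t * pre_ip K r [p]" for p r
    by (induction r) (auto simp: pre_ip_def pre_scale_def algebra_simps split: prod.splits)
  show "pre_ip K (pre_scale t r) s = t * pre_ip K r s"
  proof (induction s)
    case (Cons p s)
    show ?case
      using 2 Cons by (subst (1 2) pre_ip_Cons(2)) (simp add: algebra_simps)
  qed simp
qed

lemma pre_diff_eq_scale: "pre_diff r s = r @ pre_scale (-1) s"
  by (simp add: pre_diff_def pre_scale_def)

lemma pre_ip_diff [simp]:
  "pre_ip K (pre_diff r r') s = pre_ip K r s - pre_ip K r' s"
  "pre_ip K r (pre_diff s s') = pre_ip K r s - pre_ip K r s'"
  by (simp_all add: pre_diff_eq_scale)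

lemma pre_eval_eq_ip: "pre_eval K r z = pre_ip K r [(1,z)]"
  by (simp add: pre_eval_def pre_ip_def case_prod_beta)

text \<open>The reproducing property on finite combinations: pointwise limits of evaluations become
  limits of inner products with a fixed combination.\<close>

lemma pre_ip_eq_sum_eval: "pre_ip K r s = (\<Sum>(c,x)\<leftarrow>s. c * pre_eval K r x)"
proof (induction s)
  case (Cons p s)
  obtain c x where p: "p = (c, x)" by force
  have "pre_ip K r [p] = c * pre_ip K r [(1,x)]"
    using pre_ip_scale(2)[of K r c "[(1,x)]"] by (simp add: p pre_scale_def)
  with Cons show ?case
    by (subst pre_ip_Cons(2)) (simp add: p pre_eval_eq_ip)
qed simp

lemma snd_set_pre_scale [simp]: "snd ` set (pre_scale t r) = snd ` set r"
  by (force simp: pre_scale_def)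

lemma snd_set_pre_diff [simp]: "snd ` set (pre_diff r s) = snd ` set r \<union> snd ` set s"
  by (simp add: pre_diff_eq_scale image_Un)

text \<open>Kept apart from positivity: for measures, the expansion identities proved here are
  themselves used to establish that the form is nonnegative.\<close>

locale symmetric_form =
  fixes S :: "'a set" and K :: "'a \<Rightarrow> 'a \<Rightarrow> real"
  assumes sym: "\<lbrakk>x \<in> S; y \<in> S\<rbrakk> \<Longrightarrow> K x y = K y x"
begin

lemma ip_commute:
  assumes "snd ` set r \<subseteq> S" "snd ` set s \<subseteq> S"
  shows "pre_ip K r s = pre_ip K s r"
proof -
  have 1: "pre_ip K [p] s = pre_ip K s [p]" if "snd p \<in> S" "snd ` set s \<subseteq> S" for p s
    using that
  proof (induction s)
    case (Cons q s)
    then show ?case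
      by (subst pre_ip_Cons(1), subst pre_ip_Cons(2))
         (cases p; cases q; auto simp: sym)
  qed simp
  show ?thesis
    using assms(1)
  proof (induction r)
    case (Cons p r)
    then show ?case
      using 1[of p s] assms(2) by (subst pre_ip_Cons(1), subst pre_ip_Cons(2)) auto
  qed simp
qed

lemma nsq_append:
  assumes "snd ` set r \<subseteq> S" "snd ` set s \<subseteq> S"
  shows "pre_nsq K (r @ s) = pre_nsq K r + 2 * pre_ip K r s + pre_nsq K s"
  using ip_commute[OF assms] by (simp add: pre_nsq_eq_ip)

lemma nsq_diff:
  assumes "snd ` set r \<subseteq> S" "snd ` set s \<subseteq> S"
  shows "pre_nsq K (pre_diff r s) = pre_nsq K r - 2 * pre_ip K r s + pre_nsq K s"
  using ip_commute[OF assms] by (simp add: pre_nsq_eq_ip)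

lemma nsq_diff_commute:
  assumes "snd ` set r \<subseteq> S" "snd ` set s \<subseteq> S"
  shows "pre_nsq K (pre_diff r s) = pre_nsq K (pre_diff s r)"
  using ip_commute[OF assms] by (simp add: pre_nsq_eq_ip)

end

locale psd_form = symmetric_form +
  assumes nonneg: "snd ` set r \<subseteq> S \<Longrightarrow> 0 \<le> pre_nsq K r"
begin

lemma Cauchy_Schwarz:
  assumes r: "snd ` set r \<subseteq> S" and s: "snd ` set s \<subseteq> S"
  shows "(pre_ip K r s)\<^sup>2 \<le> pre_nsq K r * pre_nsq K s"
proof -
  have quad: "0 \<le> pre_nsq K r + 2 * t * pre_ip K r s + t\<^sup>2 * pre_nsq K s" for t
  proof -
    have "0 \<le> pre_nsq K (r @ pre_scale t s)"
      using r s by (intro nonneg) (simp add: image_Un)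
    then show ?thesis
      using r s by (subst (asm) nsq_append) (auto simp: pre_nsq_eq_ip power2_eq_square algebra_simps)
  qed
  define a b c where "a = pre_nsq K r" and "b = pre_ip K r s" and "c = pre_nsq K s"
  have q: "0 \<le> a + 2 * t * b + t\<^sup>2 * c" for t
    using quad[of t] by (simp add: a_def b_def c_def)
  have c0: "0 \<le> c" "0 \<le> a" using nonneg r s by (auto simp: c_def a_def)
  have "b\<^sup>2 \<le> a * c"
  \<comment> \<open>The form is only semidefinite, so \<open>s\<close> may have norm zero. Then the
    quadratic is affine in \<open>t\<close>, and the chosen \<open>t\<close> would give it the value
    -1 unless \<open>b\<close> vanishes. Otherwise \<open>t = - b / c\<close> is its
    minimiser.\<close>
  proof (cases "c = 0")
    case True
    have "b = 0"
    proof (rule ccontr)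
      assume "b \<noteq> 0"
      then show False
        using q[of "- (a + 1) / (2 * b)"] True by (simp add: field_simps)
    qed
    then show ?thesis using c0 by simp
  next
    case False
    have "0 \<le> a - b\<^sup>2 / c"
      using q[of "- b / c"] False by (simp add: power2_eq_square field_simps)
    then show ?thesis using c0 False by (simp add: field_simps)
  qed
  then show ?thesis by (simp add: a_def b_def c_def)
qed

text \<open>The parallelogram law with the square norm of \<open>(r - u) + (s - u)\<close>
  discarded. The factor 2 is harmless in limits, and square roots are avoided.\<close>

lemma nsq_diff_triangle:
  assumes "snd ` set r \<subseteq> S" "snd ` set s \<subseteq> S" "snd ` set u \<subseteq> S"
  shows "pre_nsq K (pre_diff r s) \<le> 2 * pre_nsq K (pre_diff r u) + 2 * pre_nsq K (pre_diff s u)"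
proof -
  have "0 \<le> pre_nsq K (pre_diff r u @ pre_diff s u)"
    using assms by (intro nonneg) (simp add: image_Un)
  then show ?thesis
    using assms ip_commute[OF assms(1,2)] ip_commute[OF assms(1,3)] ip_commute[OF assms(2,3)]
    by (simp add: pre_nsq_eq_ip algebra_simps)
qed

lemma ip_tendsto:
  assumes r: "\<And>n. snd ` set (r n) \<subseteq> S" and L: "snd ` set L \<subseteq> S" and s: "snd ` set s \<subseteq> S"
    and lim: "(\<lambda>n. pre_nsq K (pre_diff (r n) L)) \<longlonglongrightarrow> 0"
  shows "(\<lambda>n. pre_ip K (r n) s) \<longlonglongrightarrow> pre_ip K L s"
proof -
  have "(\<lambda>n. (pre_ip K (pre_diff (r n) L) s)\<^sup>2) \<longlonglongrightarrow> 0"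
  proof (rule tendsto_sandwich[OF _ _ tendsto_const])
    show "(\<lambda>n. pre_nsq K (pre_diff (r n) L) * pre_nsq K s) \<longlonglongrightarrow> 0"
      using tendsto_mult_left_zero[OF lim] by simp
    show "\<forall>\<^sub>F n in sequentially. (pre_ip K (pre_diff (r n) L) s)\<^sup>2
            \<le> pre_nsq K (pre_diff (r n) L) * pre_nsq K s"
      by (intro always_eventually allI Cauchy_Schwarz) (use r L s in auto)
  qed auto
  then have "(\<lambda>n. pre_ip K (r n) s - pre_ip K L s) \<longlonglongrightarrow> 0"
    by (simp add: power_tendsto_0_iff)
  then show ?thesis by (simp add: LIM_zero_iff)
qed

lemma nsq_tendsto:
  assumes r: "\<And>n. snd ` set (r n) \<subseteq> S" and L: "snd ` set L \<subseteq> S"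
    and lim: "(\<lambda>n. pre_nsq K (pre_diff (r n) L)) \<longlonglongrightarrow> 0"
  shows "(\<lambda>n. pre_nsq K (r n)) \<longlonglongrightarrow> pre_nsq K L"
proof -
  have "(\<lambda>n. pre_nsq K (pre_diff (r n) L) + 2 * pre_ip K (r n) L - pre_nsq K L)
          \<longlonglongrightarrow> 0 + 2 * pre_ip K L L - pre_nsq K L"
    by (intro tendsto_intros lim ip_tendsto[OF r L L lim])
  then show ?thesis
    unfolding nsq_diff[OF r L] by (simp add: pre_nsq_eq_ip)
qed

text \<open>A Cauchy sequence converging pointwise to zero converges to zero in norm:
  expand \<open>\<parallel>s n\<parallel>\<^sup>2 = \<parallel>s n - s N\<parallel>\<^sup>2 + 2 \<langle>s n, s N\<rangle> - \<parallel>s N\<parallel>\<^sup>2\<close>.\<close>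

lemma rkhs_approx_unique:
  assumes r: "rkhs_approx S K f r" and r': "rkhs_approx S K f r'"
  shows "(\<lambda>n. pre_nsq K (pre_diff (r n) (r' n))) \<longlonglongrightarrow> 0"
proof (rule LIMSEQ_I)
  fix e :: real assume e: "0 < e"
  define s where "s n = pre_diff (r n) (r' n)" for n
  have rS: "snd ` set (r n) \<subseteq> S" "snd ` set (r' n) \<subseteq> S" for n
    using r r' by (auto simp: rkhs_approx_def)
  have sS: "snd ` set (s n) \<subseteq> S" for n
    using rS by (simp add: s_def)
  obtain N1 where N1: "\<And>n n'. \<lbrakk>n \<ge> N1; n' \<ge> N1\<rbrakk> \<Longrightarrow> pre_nsq K (pre_diff (r n) (r n')) < e / 8"
    using r e unfolding rkhs_approx_def by (meson zero_less_divide_iff zero_less_numeral)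
  obtain N2 where N2: "\<And>n n'. \<lbrakk>n \<ge> N2; n' \<ge> N2\<rbrakk> \<Longrightarrow> pre_nsq K (pre_diff (r' n) (r' n')) < e / 8"
    using r' e unfolding rkhs_approx_def by (meson zero_less_divide_iff zero_less_numeral)
  define N where "N = max N1 N2"
  \<comment> \<open>As \<open>s n - s N\<close> is the difference of \<open>r n - r N\<close> and
    \<open>r' n - r' N\<close>, the parallelogram law bounds its square norm by twice the sum of two
    terms below \<open>e / 8\<close>.\<close>
  have close: "pre_nsq K (pre_diff (s n) (s N)) < e / 2" if "n \<ge> N" for n
  proof -
    have "0 \<le> pre_nsq K (pre_diff (r n) (r N) @ pre_diff (r' n) (r' N))"
      by (intro nonneg) (use rS in \<open>simp add: image_Un\<close>)
    then have "pre_nsq K (pre_diff (s n) (s N))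
        \<le> 2 * pre_nsq K (pre_diff (r n) (r N)) + 2 * pre_nsq K (pre_diff (r' n) (r' N))"
      using ip_commute[OF rS(1) rS(2), of n n] ip_commute[OF rS(1) rS(2), of n N]
        ip_commute[OF rS(1) rS(2), of N n] ip_commute[OF rS(1) rS(2), of N N]
        ip_commute[OF rS(1) rS(1), of N n] ip_commute[OF rS(2) rS(2), of N n]
      by (simp add: pre_nsq_eq_ip algebra_simps s_def)
    then show ?thesis
      using N1[of n N] N2[of n N] that by (simp add: N_def)
  qed
  have ev: "(\<lambda>n. pre_eval K (s n) z) \<longlonglongrightarrow> 0" if "z \<in> S" for z
  proof -
    have "(\<lambda>n. pre_eval K (r n) z - pre_eval K (r' n) z) \<longlonglongrightarrow> f z - f z"
      using r r' that by (intro tendsto_diff) (auto simp: rkhs_approx_def)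
    then show ?thesis by (simp add: s_def pre_eval_eq_ip)
  qed
  have ip0: "(\<lambda>n. pre_ip K (s n) q) \<longlonglongrightarrow> 0" if "snd ` set q \<subseteq> S" for q
    using that
  proof (induction q)
    case (Cons p q)
    have "(\<lambda>n. fst p * pre_eval K (s n) (snd p) + pre_ip K (s n) q) \<longlonglongrightarrow> fst p * 0 + 0"
      using Cons by (intro tendsto_intros ev) auto
    then show ?case
      by (simp add: pre_ip_eq_sum_eval case_prod_beta)
  qed simp
  from LIMSEQ_D[OF ip0[OF sS[of N]], of "e / 4"] e
  obtain N3 where N3: "\<And>n. n \<ge> N3 \<Longrightarrow> \<bar>pre_ip K (s n) (s N)\<bar> < e / 4"
    by auto
  show "\<exists>no. \<forall>n\<ge>no. norm (pre_nsq K (pre_diff (r n) (r' n)) - 0) < e"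
  proof (intro exI allI impI)
    fix n assume n: "n \<ge> max N N3"
    have "pre_nsq K (s n) = pre_nsq K (pre_diff (s n) (s N)) + 2 * pre_ip K (s n) (s N) - pre_nsq K (s N)"
      using nsq_diff[OF sS sS] by simp
    then have "pre_nsq K (s n) < e"
      using close[of n] N3[of n] n nonneg[OF sS[of N]] by linarith
    then show "norm (pre_nsq K (pre_diff (r n) (r' n)) - 0) < e"
      using nonneg[OF sS[of n]] unfolding s_def[symmetric] by simp
  qed
qed

end

text \<open>Positions in the list index the points, so repeated points cause no trouble:
  \<open>pd_kernel\<close> allows repetitions as well.\<close>

lemma psd_form_if_pd_kernel:
  assumes "pd_kernel S K"
  shows "psd_form S K"
proof
  show "K x y = K y x" if "x \<in> S" "y \<in> S" for x y
    using assms that by (simp add: pd_kernel_def)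
  show "0 \<le> pre_nsq K r" if "snd ` set r \<subseteq> S" for r
  proof -
    have "\<forall>j<length r. snd (r ! j) \<in> S"
      using that by auto
    then have "0 \<le> (\<Sum>j<length r. \<Sum>l<length r. fst (r ! j) * fst (r ! l) * K (snd (r ! j)) (snd (r ! l)))"
      using assms by (auto simp: pd_kernel_def)
    also have "\<dots> = pre_nsq K r"
      by (simp add: pre_nsq_def sum_list_sum_nth case_prod_beta atLeast0LessThan)
    finally show ?thesis .
  qed
qed

section \<open>Schur products of kernels\<close>

text \<open>Matrices indexed by an arbitrary set rather than an initial segment, so that an
  induction can remove one index at a time.\<close>

definition psd_on :: "'i set \<Rightarrow> ('i \<Rightarrow> 'i \<Rightarrow> real) \<Rightarrow> bool" where
  "psd_on I A \<longleftrightarrow> (\<forall>i\<in>I. \<forall>j\<in>I. A i j = A j i) \<and>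
     (\<forall>c. 0 \<le> (\<Sum>i\<in>I. \<Sum>j\<in>I. c i * c j * A i j))"

lemma psd_onD:
  assumes "psd_on I A"
  shows "\<lbrakk>i \<in> I; j \<in> I\<rbrakk> \<Longrightarrow> A i j = A j i" "0 \<le> (\<Sum>i\<in>I. \<Sum>j\<in>I. c i * c j * A i j)"
  using assms unfolding psd_on_def by blast+

lemma psd_on_insert_expand:
  fixes c :: "'i \<Rightarrow> real"
  assumes I: "finite I" "p \<notin> I" and sym: "\<forall>i\<in>insert p I. \<forall>j\<in>insert p I. A i j = A j i"
  shows "(\<Sum>i\<in>insert p I. \<Sum>j\<in>insert p I. c i * c j * A i j)
    = (c p)\<^sup>2 * A p p + 2 * c p * (\<Sum>j\<in>I. c j * A p j) + (\<Sum>i\<in>I. \<Sum>j\<in>I. c i * c j * A i j)"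
proof -
  have "(\<Sum>i\<in>I. c i * c p * A i p) = c p * (\<Sum>j\<in>I. c j * A p j)"
    unfolding sum_distrib_left
  proof (intro sum.cong refl)
    fix i assume "i \<in> I"
    then have "A i p = A p i" using sym by blast
    then show "c i * c p * A i p = c p * (c i * A p i)" by simp
  qed
  moreover have "(\<Sum>j\<in>I. c p * c j * A p j) = c p * (\<Sum>j\<in>I. c j * A p j)"
    by (simp add: sum_distrib_left algebra_simps)
  ultimately show ?thesis
    using I by (simp add: sum.distrib power2_eq_square)
qed

text \<open>Gaussian elimination of the pivot \<open>p\<close>: subtracting the rank-one form of the \<open>p\<close>-th row
  leaves a positive semidefinite form on the remaining indices.\<close>

lemma psd_on_pivot:
  assumes I: "finite I" "p \<notin> I" and A: "psd_on (insert p I) A"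
  obtains v where "psd_on I (\<lambda>i j. A i j - v i * v j)"
    and "\<And>j. j \<in> insert p I \<Longrightarrow> A p j = v p * v j"
proof -
  let ?J = "insert p I"
  have sym: "\<forall>i\<in>?J. \<forall>j\<in>?J. A i j = A j i"
    using psd_onD(1)[OF A] by blast
  have q: "0 \<le> (c p)\<^sup>2 * A p p + 2 * c p * (\<Sum>j\<in>I. c j * A p j) + (\<Sum>i\<in>I. \<Sum>j\<in>I. c i * c j * A i j)" for c
    using psd_onD(2)[OF A, of c] psd_on_insert_expand[OF I sym, of c] by simp
  have rest: "(\<Sum>j\<in>I. (if j = p then t else c j) * f j) = (\<Sum>j\<in>I. c j * f j)"
    "(\<Sum>i\<in>I. \<Sum>j\<in>I. (if i = p then t else c i) * (if j = p then t else c j) * A i j)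
      = (\<Sum>i\<in>I. \<Sum>j\<in>I. c i * c j * A i j)" for t c f
    using I by (auto intro!: sum.cong)
  have q': "0 \<le> t\<^sup>2 * A p p + 2 * t * (\<Sum>j\<in>I. c j * A p j) + (\<Sum>i\<in>I. \<Sum>j\<in>I. c i * c j * A i j)" for c t
    using q[of "\<lambda>j. if j = p then t else c j"] by (simp add: rest)
  have a0: "0 \<le> A p p"
    using q'[of 1 "\<lambda>_. 0"] by simp
  \<comment> \<open>If the pivot is zero, division by zero makes \<open>v\<close> vanish and nothing
    is subtracted; \<open>zero\<close> shows that the row to be eliminated vanishes too.\<close>
  define v where "v j = A p j / sqrt (A p p)" for j
  have zero: "A p j = 0" if "A p p = 0" "j \<in> I" for j
  proof (rule ccontr)
    assume ne: "A p j \<noteq> 0"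
    define e where "e i = (if i = j then 1 else 0 :: real)" for i
    define w where "w = (\<Sum>i\<in>I. \<Sum>l\<in>I. e i * e l * A i l)"
    have "(\<Sum>i\<in>I. e i * A p i) = A p j"
      using I that by (simp add: e_def if_distrib[of "\<lambda>x. x * _"] cong: if_cong)
    \<comment> \<open>A zero pivot makes the form affine in \<open>t\<close>; this \<open>t\<close>
      would give it the value -1.\<close>
    then have "0 \<le> 2 * (- (w + 1) / (2 * A p j)) * A p j + w"
      using q'[of "- (w + 1) / (2 * A p j)" e] that unfolding w_def[symmetric] by simp
    then show False
      using ne by (simp add: field_simps)
  qed
  show thesis
  proof
    show "A p j = v p * v j" if "j \<in> ?J" for j
      using that zero a0 by (cases "A p p = 0") (auto simp: v_def)
    show "psd_on I (\<lambda>i j. A i j - v i * v j)"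
      unfolding psd_on_def
    proof (intro conjI ballI allI)
      fix i j assume "i \<in> I" "j \<in> I"
      then show "A i j - v i * v j = A j i - v j * v i"
        using sym by (metis insertCI mult.commute)
    next
      fix c :: "'a \<Rightarrow> real"
      have sq: "(\<Sum>i\<in>I. \<Sum>j\<in>I. c i * c j * (v i * v j)) = (\<Sum>j\<in>I. c j * v j)\<^sup>2"
        by (simp add: power2_eq_square sum_product algebra_simps)
      have sum_v: "(\<Sum>j\<in>I. c j * v j) = (\<Sum>j\<in>I. c j * A p j) / sqrt (A p p)"
        by (simp add: v_def sum_divide_distrib)
      define b where "b = (\<Sum>j\<in>I. c j * A p j)"
      define w where "w = (\<Sum>i\<in>I. \<Sum>j\<in>I. c i * c j * A i j)"
      \<comment> \<open>\<open>t = - b / A p p\<close> minimises the quadratic polynomial; for a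
        zero pivot it is 0, and the claim reduces to nonnegativity of \<open>w\<close>.\<close>
      have "0 \<le> (- b / A p p)\<^sup>2 * A p p + 2 * (- b / A p p) * b + w"
        using q'[of "- b / A p p" c] by (simp only: b_def w_def)
      then have "b\<^sup>2 / A p p \<le> w"
        by (cases "A p p = 0") (auto simp: power2_eq_square)
      then have "b\<^sup>2 / A p p \<le> (\<Sum>i\<in>I. \<Sum>j\<in>I. c i * c j * A i j)"
        by (simp only: w_def)
      then show "0 \<le> (\<Sum>i\<in>I. \<Sum>j\<in>I. c i * c j * (A i j - v i * v j))"
        using a0 by (simp add: right_diff_distrib sum_subtractf sq sum_v power_divide b_def)
    qed
  qed
qed

text \<open>Schur's product theorem by elimination: write \<open>A\<close> as the rank-one matrix
  \<open>v i * v j\<close> plus a remainder whose row and column \<open>p\<close> vanish.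
  Multiplying \<open>B\<close> entrywise by the rank-one part only rescales the coefficients
  \<open>c i\<close> to \<open>c i * v i\<close>. The remainder is covered by the induction
  hypothesis, which is why \<open>A\<close> is generalised.\<close>

lemma psd_on_mult:
  assumes "finite I" "psd_on I A" "psd_on I B"
  shows "psd_on I (\<lambda>i j. A i j * B i j)"
  using assms
proof (induction I arbitrary: A rule: finite_induct)
  case empty
  then show ?case by (simp add: psd_on_def)
next
  case (insert p I)
  obtain v where v: "psd_on I (\<lambda>i j. A i j - v i * v j)"
    and vp: "\<And>j. j \<in> insert p I \<Longrightarrow> A p j = v p * v j"
    by (rule psd_on_pivot[OF insert.hyps insert.prems(1)], rule that)
  have symA: "A i p = v i * v p" if "i \<in> insert p I" for i
    using vp[OF that] psd_onD(1)[OF insert.prems(1), of i p] that by (simp add: mult.commute)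
  have BI: "psd_on I B"
    unfolding psd_on_def
  proof (intro conjI ballI allI)
    fix c :: "'a \<Rightarrow> real"
    have sm: "(\<Sum>i\<in>I. \<Sum>j\<in>I. (if i = p then 0 else c i) * (if j = p then 0 else c j) * B i j)
        = (\<Sum>i\<in>I. \<Sum>j\<in>I. c i * c j * B i j)"
      using insert.hyps by (auto intro!: sum.cong)
    show "0 \<le> (\<Sum>i\<in>I. \<Sum>j\<in>I. c i * c j * B i j)"
      using psd_onD(2)[OF insert.prems(2), of "\<lambda>j. if j = p then 0 else c j"] insert.hyps sm by simp
  qed (rule psd_onD(1)[OF insert.prems(2)]; blast)
  note IH = insert.IH[OF v BI]
  show ?case
    unfolding psd_on_def
  proof (intro conjI ballI allI)
    fix i j assume "i \<in> insert p I" "j \<in> insert p I"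
    then show "A i j * B i j = A j i * B j i"
      using psd_onD(1)[OF insert.prems(1), of i j] psd_onD(1)[OF insert.prems(2), of i j] by simp
  next
    fix c :: "'a \<Rightarrow> real"
    define D where "D i j = (A i j - v i * v j) * B i j" for i j
    have D0: "D p j = 0" "D j p = 0" if "j \<in> insert p I" for j
      using vp[OF that] symA[OF that] by (simp_all add: D_def)
    have "(\<Sum>i\<in>insert p I. \<Sum>j\<in>insert p I. c i * c j * (A i j * B i j))
       = (\<Sum>i\<in>insert p I. \<Sum>j\<in>insert p I. c i * c j * D i j)
         + (\<Sum>i\<in>insert p I. \<Sum>j\<in>insert p I. (c i * v i) * (c j * v j) * B i j)"
      unfolding sum.distrib[symmetric] by (intro sum.cong refl) (simp add: D_def algebra_simps)
    also have "(\<Sum>i\<in>insert p I. \<Sum>j\<in>insert p I. c i * c j * D i j)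
       = (\<Sum>i\<in>I. \<Sum>j\<in>I. c i * c j * D i j)"
      using insert.hyps by (simp add: D0)
    finally show "0 \<le> (\<Sum>i\<in>insert p I. \<Sum>j\<in>insert p I. c i * c j * (A i j * B i j))"
      using psd_onD(2)[OF IH, of c] psd_onD(2)[OF insert.prems(2), of "\<lambda>i. c i * v i"]
      by (simp only: D_def[symmetric])
  qed
qed

lemma pd_kernel_iff_psd_on:
  "pd_kernel S K \<longleftrightarrow> (\<forall>x\<in>S. \<forall>y\<in>S. K x y = K y x) \<and>
     (\<forall>(n::nat) x. (\<forall>j<n. x j \<in> S) \<longrightarrow> psd_on {..<n} (\<lambda>i j. K (x i) (x j)))"
  unfolding pd_kernel_def psd_on_def by blast

lemma pd_kernel_mult:
  assumes "pd_kernel S K" "pd_kernel S K'"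
  shows "pd_kernel S (\<lambda>x y. K x y * K' x y)"
proof -
  have "K x y * K' x y = K y x * K' y x" if "x \<in> S" "y \<in> S" for x y
    using assms that unfolding pd_kernel_def by metis
  then show ?thesis
    using assms psd_on_mult[OF finite_lessThan] unfolding pd_kernel_iff_psd_on by blast
qed

lemma pd_kernel_one: "pd_kernel S (\<lambda>x y. 1)"
proof -
  have "(\<Sum>j<n. \<Sum>l<n. c j * c l * 1) = (\<Sum>j<n. c j)\<^sup>2" for c :: "nat \<Rightarrow> real" and n
    by (simp add: power2_eq_square sum_product)
  then show ?thesis by (simp add: pd_kernel_def)
qed

lemma pd_kernel_prod:
  assumes "finite J" "\<And>j. j \<in> J \<Longrightarrow> pd_kernel S (K j)"
  shows "pd_kernel S (\<lambda>x y. \<Prod>j\<in>J. K j x y)"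
  using assms by (induction J rule: finite_induct) (auto intro: pd_kernel_one pd_kernel_mult)

lemma pd_kernel_comp:
  assumes "pd_kernel T K" "\<And>x. x \<in> S \<Longrightarrow> g x \<in> T"
  shows "pd_kernel S (\<lambda>x y. K (g x) (g y))"
  unfolding pd_kernel_def
proof (intro conjI ballI allI impI)
  fix n :: nat and c :: "nat \<Rightarrow> real" and x assume "\<forall>j<n. x j \<in> S"
  then have "\<forall>j<n. (g \<circ> x) j \<in> T" using assms(2) by simp
  then show "0 \<le> (\<Sum>j<n. \<Sum>l<n. c j * c l * K (g (x j)) (g (x l)))"
    using conjunct2[OF assms(1)[unfolded pd_kernel_def], rule_format, of n "g \<circ> x" c] by simp
next
  fix x y assume "x \<in> S" "y \<in> S"
  then show "K (g x) (g y) = K (g y) (g x)"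
    using assms unfolding pd_kernel_def by blast
qed

section \<open>Mean embeddings of probability measures\<close>

text \<open>The inner product of two mean embeddings. Having the type of a kernel on measures, it
  fits \<open>pre_ip\<close> and both form locales, with measures in the role of points.\<close>

definition kmean :: "('a \<Rightarrow> 'a \<Rightarrow> real) \<Rightarrow> 'a measure \<Rightarrow> 'a measure \<Rightarrow> real" where
  "kmean K \<mu> \<nu> = (\<integral>x. \<integral>y. K x y \<partial>\<nu> \<partial>\<mu>)"

definition prob_measures :: "'a measure \<Rightarrow> 'a measure set" where
  "prob_measures M = {\<mu>. prob_space \<mu> \<and> sets \<mu> = sets M}"

definition dirac_comb :: "'a measure \<Rightarrow> (real \<times> 'a) list \<Rightarrow> (real \<times> 'a measure) list" where
  "dirac_comb M r = map (\<lambda>(c,x). (c, return M x)) r"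

lemma return_in_prob_measures: "x \<in> space M \<Longrightarrow> return M x \<in> prob_measures M"
  by (simp add: prob_measures_def prob_space_return)

lemma snd_set_dirac_comb:
  "snd ` set r \<subseteq> space M \<Longrightarrow> snd ` set (dirac_comb M r) \<subseteq> prob_measures M"
  by (force simp: dirac_comb_def intro!: return_in_prob_measures)

locale bounded_measurable_kernel =
  fixes M :: "'a measure" and K :: "'a \<Rightarrow> 'a \<Rightarrow> real" and B :: real
  assumes pd: "pd_kernel (space M) K"
    and meas: "(\<lambda>(x,y). K x y) \<in> borel_measurable (M \<Otimes>\<^sub>M M)"
    and bdd: "\<lbrakk>x \<in> space M; y \<in> space M\<rbrakk> \<Longrightarrow> \<bar>K x y\<bar> \<le> B"
begin

sublocale pt: psd_form "space M" K
  by (rule psd_form_if_pd_kernel[OF pd])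

lemma prob_measuresD:
  assumes "\<mu> \<in> prob_measures M"
  shows "prob_space \<mu>" "sets \<mu> = sets M" "space \<mu> = space M"
  using assms by (auto simp: prob_measures_def dest: sets_eq_imp_space_eq)

lemma meas_section [measurable]:
  assumes "x \<in> space M"
  shows "K x \<in> borel_measurable M" "(\<lambda>y. K y x) \<in> borel_measurable M"
  using measurable_compose[OF measurable_Pair1'[OF assms] meas]
    measurable_compose[OF measurable_Pair2'[OF assms] meas] by simp_all

lemma integrable_section:
  assumes "\<mu> \<in> prob_measures M" "x \<in> space M"
  shows "integrable \<mu> (K x)"
proof -
  interpret prob_space \<mu> by (rule prob_measuresD(1)[OF assms(1)])
  show ?thesis
    by (rule integrable_const_bound[where B=B])
       (use assms bdd meas_section[OF assms(2)] prob_measuresD[OF assms(1)] in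
          \<open>auto cong: measurable_cong_sets\<close>)
qed

lemma abs_integral_section_le:
  assumes "\<mu> \<in> prob_measures M" "x \<in> space M"
  shows "\<bar>\<integral>y. K x y \<partial>\<mu>\<bar> \<le> B"
proof -
  interpret prob_space \<mu> by (rule prob_measuresD(1)[OF assms(1)])
  have "\<bar>\<integral>y. K x y \<partial>\<mu>\<bar> \<le> (\<integral>y. \<bar>K x y\<bar> \<partial>\<mu>)"
    by (rule integral_abs_bound)
  also have "\<dots> \<le> (\<integral>y. B \<partial>\<mu>)"
    using integrable_section[OF assms] bdd[OF assms(2)] prob_measuresD(3)[OF assms(1)]
    by (intro integral_mono) auto
  finally show ?thesis by (simp add: prob_space)
qed

lemma measurable_integral_section:
  assumes "\<mu> \<in> prob_measures M"
  shows "(\<lambda>x. \<integral>y. K x y \<partial>\<mu>) \<in> borel_measurable M"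
proof -
  interpret prob_space \<mu> by (rule prob_measuresD(1)[OF assms(1)])
  have "case_prod K \<in> borel_measurable (M \<Otimes>\<^sub>M \<mu>)"
    using meas prob_measuresD(2)[OF assms]
    by (simp cong: measurable_cong_sets sets_pair_measure_cong)
  then show ?thesis by (rule borel_measurable_lebesgue_integral)
qed

lemma integrable_integral_section:
  assumes "\<mu> \<in> prob_measures M" "\<nu> \<in> prob_measures M"
  shows "integrable \<nu> (\<lambda>x. \<integral>y. K x y \<partial>\<mu>)"
proof -
  interpret prob_space \<nu> by (rule prob_measuresD(1)[OF assms(2)])
  show ?thesis
    by (rule integrable_const_bound[where B=B])
       (use assms abs_integral_section_le measurable_integral_section prob_measuresD in
          \<open>auto cong: measurable_cong_sets\<close>)
qed

lemma abs_kmean_le: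
  assumes "\<mu> \<in> prob_measures M" "\<nu> \<in> prob_measures M"
  shows "\<bar>kmean K \<mu> \<nu>\<bar> \<le> B"
proof -
  interpret prob_space \<mu> by (rule prob_measuresD(1)[OF assms(1)])
  have "\<bar>kmean K \<mu> \<nu>\<bar> \<le> (\<integral>x. \<bar>\<integral>y. K x y \<partial>\<nu>\<bar> \<partial>\<mu>)"
    unfolding kmean_def by (rule integral_abs_bound)
  also have "\<dots> \<le> (\<integral>y. B \<partial>\<mu>)"
    using integrable_integral_section[OF assms(2,1)] abs_integral_section_le[OF assms(2)]
      prob_measuresD(3)[OF assms(1)]
    by (intro integral_mono) auto
  finally show ?thesis by (simp add: prob_space)
qed

lemma
  assumes "\<mu> \<in> prob_measures M" "\<nu> \<in> prob_measures M"
  shows kmean_eq_pair_integral: "kmean K \<mu> \<nu> = (\<integral>p. K (fst p) (snd p) \<partial>(\<mu> \<Otimes>\<^sub>M \<nu>))"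
    and kmean_swap: "kmean K \<mu> \<nu> = (\<integral>y. \<integral>x. K x y \<partial>\<mu> \<partial>\<nu>)"
proof -
  interpret \<mu>: prob_space \<mu> by (rule prob_measuresD(1)[OF assms(1)])
  interpret \<nu>: prob_space \<nu> by (rule prob_measuresD(1)[OF assms(2)])
  interpret pair_prob_space \<mu> \<nu> ..
  have sets: "sets (\<mu> \<Otimes>\<^sub>M \<nu>) = sets (M \<Otimes>\<^sub>M M)"
    using assms by (intro sets_pair_measure_cong prob_measuresD(2))
  have "integrable (\<mu> \<Otimes>\<^sub>M \<nu>) (case_prod K)"
  proof (rule integrable_const_bound[where B=B])
    show "case_prod K \<in> borel_measurable (\<mu> \<Otimes>\<^sub>M \<nu>)"
      using meas sets by (simp cong: measurable_cong_sets)
    show "AE p in \<mu> \<Otimes>\<^sub>M \<nu>. norm (case_prod K p) \<le> B"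
      using bdd prob_measuresD(3)[OF assms(1)] prob_measuresD(3)[OF assms(2)]
      by (intro AE_I2) (auto simp: space_pair_measure)
  qed
  then show "kmean K \<mu> \<nu> = (\<integral>p. K (fst p) (snd p) \<partial>(\<mu> \<Otimes>\<^sub>M \<nu>))"
    "kmean K \<mu> \<nu> = (\<integral>y. \<integral>x. K x y \<partial>\<mu> \<partial>\<nu>)"
    using integral_fst'[of "case_prod K"] Fubini_integral[of K]
    by (simp_all add: kmean_def case_prod_beta')
qed

lemma kmean_commute:
  assumes "\<mu> \<in> prob_measures M" "\<nu> \<in> prob_measures M"
  shows "kmean K \<mu> \<nu> = kmean K \<nu> \<mu>"
  unfolding kmean_swap[OF assms] kmean_def[of K \<nu>]
  using prob_measuresD(3)[OF assms(1)] prob_measuresD(3)[OF assms(2)]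
  by (intro Bochner_Integration.integral_cong refl pt.sym) auto

lemma kmean_return_left:
  assumes "\<mu> \<in> prob_measures M" "x \<in> space M"
  shows "kmean K (return M x) \<mu> = (\<integral>y. K x y \<partial>\<mu>)"
  unfolding kmean_def by (rule integral_return[OF assms(2) measurable_integral_section[OF assms(1)]])

lemma kmean_return_right:
  assumes "\<mu> \<in> prob_measures M" "x \<in> space M"
  shows "kmean K \<mu> (return M x) = (\<integral>y. K x y \<partial>\<mu>)"
  using kmean_commute[OF assms(1) return_in_prob_measures[OF assms(2)]] kmean_return_left[OF assms]
  by simp

lemma kmean_return_return:
  assumes "x \<in> space M" "y \<in> space M"
  shows "kmean K (return M x) (return M y) = K x y"
  using kmean_return_left[OF return_in_prob_measures[OF assms(2)] assms(1)]
    integral_return[OF assms(2) meas_section(1)[OF assms(1)]] by simp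

sublocale ms: symmetric_form "prob_measures M" "kmean K"
  by standard (rule kmean_commute)

lemma
  assumes "snd ` set L \<subseteq> prob_measures M" "\<mu> \<in> prob_measures M"
  shows integrable_eval_return: "integrable \<mu> (\<lambda>x. pre_eval (kmean K) L (return M x))"
    and integral_eval_return: "(\<integral>x. pre_eval (kmean K) L (return M x) \<partial>\<mu>) = pre_eval (kmean K) L \<mu>"
proof -
  have "integrable \<mu> (\<lambda>x. pre_eval (kmean K) L (return M x)) \<and>
    (\<integral>x. pre_eval (kmean K) L (return M x) \<partial>\<mu>) = pre_eval (kmean K) L \<mu>"
    using assms(1)
  proof (induction L)
    case Nil
    then show ?case by (simp add: pre_eval_def)
  next
    case (Cons p L)
    obtain c \<nu> where p: "p = (c, \<nu>)" by force
    have \<nu>: "\<nu> \<in> prob_measures M" using Cons.prems by (simp add: p)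
    have eq: "kmean K \<nu> (return M x) = (\<integral>y. K x y \<partial>\<nu>)" if "x \<in> space \<mu>" for x
      using kmean_return_right[OF \<nu>] that prob_measuresD(3)[OF assms(2)] by simp
    have int: "integrable \<mu> (\<lambda>x. kmean K \<nu> (return M x))"
      using integrable_integral_section[OF \<nu> assms(2)] eq
      by (simp cong: Bochner_Integration.integrable_cong)
    have "(\<integral>x. kmean K \<nu> (return M x) \<partial>\<mu>) = kmean K \<mu> \<nu>"
      unfolding kmean_def[of K \<mu>] by (intro Bochner_Integration.integral_cong refl eq)
    then show ?case
      using Cons int kmean_commute[OF assms(2) \<nu>] by (simp add: pre_eval_def p)
  qed
  then show "integrable \<mu> (\<lambda>x. pre_eval (kmean K) L (return M x))"
    "(\<integral>x. pre_eval (kmean K) L (return M x) \<partial>\<mu>) = pre_eval (kmean K) L \<mu>" by auto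
qed

section \<open>Replacing measures by point masses\<close>

lemma nsq_append_single:
  assumes "snd ` set L \<subseteq> prob_measures M" "\<mu> \<in> prob_measures M"
  shows "pre_nsq (kmean K) (L @ [(t,\<mu>)])
     = pre_nsq (kmean K) L + 2 * t * pre_eval (kmean K) L \<mu> + t\<^sup>2 * kmean K \<mu> \<mu>"
  using assms pre_ip_scale(2)[of "kmean K" L t "[(1,\<mu>)]"]
  by (subst ms.nsq_append) (auto simp: pre_nsq_eq_ip pre_eval_eq_ip pre_scale_def power2_eq_square)

text \<open>The averages over \<open>x\<close> of \<open>\<langle>L, \<delta>\<^sub>x\<rangle>\<close> equal \<open>\<langle>L, \<mu>\<rangle>\<close>, hence some \<open>x\<close> does not exceed the average:
  a derandomised law of large numbers, which needs no product measure.\<close>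

lemma replace_by_point:
  assumes L: "snd ` set L \<subseteq> prob_measures M" and \<mu>: "\<mu> \<in> prob_measures M"
  shows "\<exists>x\<in>space M. pre_nsq (kmean K) (L @ [(t, return M x)])
           \<le> pre_nsq (kmean K) (L @ [(t,\<mu>)]) + 2 * B * t\<^sup>2"
proof -
  interpret prob_space \<mu> by (rule prob_measuresD(1)[OF \<mu>])
  let ?e = "\<lambda>\<nu>. pre_eval (kmean K) L \<nu>"
  \<comment> \<open>The weight \<open>t\<close> may be negative, so the comparison includes the
    factor. If it failed everywhere, the mean would exceed itself.\<close>
  have "\<exists>x\<in>space M. t * ?e (return M x) \<le> t * ?e \<mu>"
  proof (rule ccontr)
    assume "\<not> ?thesis"
    then have "AE x in \<mu>. t * ?e \<mu> < t * ?e (return M x)"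
      using prob_measuresD(3)[OF \<mu>] by (intro AE_I2) (auto simp: not_le)
    then have "t * ?e \<mu> < (\<integral>x. t * ?e (return M x) \<partial>\<mu>)"
      by (intro expectation_greater integrable_mult_right integrable_eval_return L \<mu>)
    then show False
      using integral_eval_return[OF L \<mu>] by simp
  qed
  then obtain x where x: "x \<in> space M" "t * ?e (return M x) \<le> t * ?e \<mu>" by blast
  have r: "return M x \<in> prob_measures M"
    by (rule return_in_prob_measures[OF x(1)])
  \<comment> \<open>The choice of \<open>x\<close> keeps the linear term from growing; what remains
    is the diagonal, where both values are at most \<open>B\<close> in absolute value.\<close>
  have "kmean K (return M x) (return M x) - kmean K \<mu> \<mu> \<le> 2 * B"
    using abs_kmean_le[OF r r] abs_kmean_le[OF \<mu> \<mu>] by linarith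
  then have "t\<^sup>2 * (kmean K (return M x) (return M x) - kmean K \<mu> \<mu>) \<le> t\<^sup>2 * (2 * B)"
    by (intro mult_left_mono) auto
  then have "pre_nsq (kmean K) (L @ [(t, return M x)])
      \<le> pre_nsq (kmean K) (L @ [(t,\<mu>)]) + 2 * B * t\<^sup>2"
    using x unfolding nsq_append_single[OF L r] nsq_append_single[OF L \<mu>]
    by (auto simp: algebra_simps)
  then show ?thesis
    using x by blast
qed

lemma nsq_append_commute:
  assumes "snd ` set r \<subseteq> prob_measures M" "snd ` set s \<subseteq> prob_measures M"
  shows "pre_nsq (kmean K) ((L @ r) @ s) = pre_nsq (kmean K) ((L @ s) @ r)"
  using ms.ip_commute[OF assms] by (simp add: pre_nsq_eq_ip)

text \<open>The weight \<open>n * s\<close> is converted in portions of size \<open>s\<close> while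
  the rest stays on the measure, so each point is chosen with all earlier points and the remaining
  weight in view. The costs add up, and for a fixed total weight they are of order
  \<open>1 / n\<close>.\<close>

lemma replace_by_points:
  assumes L: "snd ` set L \<subseteq> prob_measures M" and \<mu>: "\<mu> \<in> prob_measures M"
  shows "\<exists>r. snd ` set r \<subseteq> space M \<and> pre_nsq (kmean K) (L @ dirac_comb M r)
           \<le> pre_nsq (kmean K) (L @ [(real n * s, \<mu>)]) + real n * (2 * B * s\<^sup>2)"
  using L
proof (induction n arbitrary: L)
  case 0
  show ?case
    by (rule exI[of _ "[]"]) (use 0 \<mu> in \<open>simp add: dirac_comb_def nsq_append_single\<close>)
next
  case (Suc n)
  let ?Q = "pre_nsq (kmean K)"
  have "snd ` set (L @ [(real n * s, \<mu>)]) \<subseteq> prob_measures M"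
    using Suc.prems \<mu> by auto
  from replace_by_point[OF this \<mu>, of s] obtain x where x: "x \<in> space M"
    and le: "?Q ((L @ [(real n * s, \<mu>)]) @ [(s, return M x)])
       \<le> ?Q ((L @ [(real n * s, \<mu>)]) @ [(s, \<mu>)]) + 2 * B * s\<^sup>2" by blast
  have rx: "return M x \<in> prob_measures M" by (rule return_in_prob_measures[OF x])
  then have "snd ` set (L @ [(s, return M x)]) \<subseteq> prob_measures M"
    using Suc.prems by auto
  from Suc.IH[OF this] obtain r where r: "snd ` set r \<subseteq> space M"
    and le': "?Q ((L @ [(s, return M x)]) @ dirac_comb M r)
       \<le> ?Q ((L @ [(s, return M x)]) @ [(real n * s, \<mu>)]) + real n * (2 * B * s\<^sup>2)" by auto
  have swap: "?Q ((L @ [(s, return M x)]) @ [(real n * s, \<mu>)]) = ?Q ((L @ [(real n * s, \<mu>)]) @ [(s, return M x)])"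
    using rx \<mu> by (intro nsq_append_commute) auto
  \<comment> \<open>As lists, two entries on the same measure differ from one entry with the summed
    weight, but the square norms agree.\<close>
  have merge: "?Q ((L @ [(real n * s, \<mu>)]) @ [(s, \<mu>)]) = ?Q (L @ [(real (Suc n) * s, \<mu>)])"
    using Suc.prems \<mu> by (simp add: nsq_append_single image_Un pre_eval_def algebra_simps power2_eq_square
        del: append_assoc)
  have "?Q (L @ dirac_comb M ((s, x) # r)) \<le> ?Q (L @ [(real (Suc n) * s, \<mu>)]) + real (Suc n) * (2 * B * s\<^sup>2)"
    using le le' swap merge by (simp add: dirac_comb_def algebra_simps)
  then show ?case
    using r x by (intro exI[of _ "(s, x) # r"]) auto
qed

text \<open>The context \<open>L\<close> carries the induction: the tail is converted while
  \<open>p\<close> is part of the context, then \<open>p\<close> is converted with the new points in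
  the context. An empty \<open>L\<close> yields positivity; taking \<open>L\<close> to be the
  negative of \<open>R\<close> yields approximation in norm.\<close>

lemma replace_all_by_points:
  assumes "snd ` set L \<subseteq> prob_measures M" "snd ` set R \<subseteq> prob_measures M" and N: "0 < N"
  shows "\<exists>r. snd ` set r \<subseteq> space M \<and> pre_nsq (kmean K) (L @ dirac_comb M r)
           \<le> pre_nsq (kmean K) (L @ R) + (2 * B * (\<Sum>(c,\<mu>)\<leftarrow>R. c\<^sup>2)) / real N"
  using assms(1,2)
proof (induction R arbitrary: L)
  case Nil
  show ?case
    by (rule exI[of _ "[]"]) (simp add: dirac_comb_def)
next
  case (Cons p R)
  let ?Q = "pre_nsq (kmean K)"
  obtain t \<mu> where p: "p = (t, \<mu>)" by force
  have \<mu>: "\<mu> \<in> prob_measures M" and R: "snd ` set R \<subseteq> prob_measures M"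
    using Cons.prems by (auto simp: p)
  obtain r where r: "snd ` set r \<subseteq> space M"
    and le: "?Q ((L @ [p]) @ dirac_comb M r) \<le> ?Q ((L @ [p]) @ R) + (2 * B * (\<Sum>(c,\<mu>)\<leftarrow>R. c\<^sup>2)) / real N"
    using Cons.IH[OF _ R, of "L @ [p]"] Cons.prems by auto
  have "snd ` set (L @ dirac_comb M r) \<subseteq> prob_measures M"
    using Cons.prems snd_set_dirac_comb[OF r] by (simp add: image_Un)
  from replace_by_points[OF this \<mu>, of N "t / real N"] obtain r' where r': "snd ` set r' \<subseteq> space M"
    and le': "?Q ((L @ dirac_comb M r) @ dirac_comb M r')
        \<le> ?Q ((L @ dirac_comb M r) @ [p]) + 2 * B * t\<^sup>2 / real N"
    using N by (auto simp: p power2_eq_square field_simps)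
  have "?Q ((L @ dirac_comb M r) @ [p]) = ?Q ((L @ [p]) @ dirac_comb M r)"
    using snd_set_dirac_comb[OF r] \<mu> by (intro nsq_append_commute) (auto simp: p)
  then have "?Q (L @ dirac_comb M (r @ r')) \<le> ?Q (L @ p # R) + (2 * B * (\<Sum>(c,\<mu>)\<leftarrow>p # R. c\<^sup>2)) / real N"
    using le le' by (simp add: dirac_comb_def p add_divide_distrib distrib_left)
  then show ?case
    using r r' by (intro exI[of _ "r @ r'"]) (auto simp: image_Un)
qed

lemma pre_ip_dirac_comb:
  assumes "snd ` set r \<subseteq> space M" "snd ` set s \<subseteq> space M"
  shows "pre_ip (kmean K) (dirac_comb M r) (dirac_comb M s) = pre_ip K r s"
proof -
  have "kmean K (return M x) (return M y) = K x y" if "(c, x) \<in> set r" "(c', y) \<in> set s" for c c' x y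
    using assms that by (intro kmean_return_return) auto
  then show ?thesis
    by (auto simp: pre_ip_def dirac_comb_def o_def case_prod_beta
        intro!: arg_cong[where f=sum_list] map_cong)
qed

lemma pre_nsq_dirac_comb:
  "snd ` set r \<subseteq> space M \<Longrightarrow> pre_nsq (kmean K) (dirac_comb M r) = pre_nsq K r"
  by (simp add: pre_nsq_eq_ip pre_ip_dirac_comb)

sublocale ms: psd_form "prob_measures M" "kmean K"
proof
  fix R :: "(real \<times> 'a measure) list" assume R: "snd ` set R \<subseteq> prob_measures M"
  define C where "C = 2 * B * (\<Sum>(c,\<mu>)\<leftarrow>R. c\<^sup>2)"
  have "0 \<le> pre_nsq (kmean K) R + C / real (Suc n)" for n
  proof -
    obtain r where r: "snd ` set r \<subseteq> space M"
      "pre_nsq (kmean K) (dirac_comb M r) \<le> pre_nsq (kmean K) R + C / real (Suc n)"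
      using replace_all_by_points[of "[]" R "Suc n"] R by (auto simp: C_def)
    then show ?thesis
      using pt.nonneg[OF r(1)] pre_nsq_dirac_comb[OF r(1)] by linarith
  qed
  moreover have "(\<lambda>n. pre_nsq (kmean K) R + C / real (Suc n)) \<longlonglongrightarrow> pre_nsq (kmean K) R + 0"
    by (intro tendsto_intros LIMSEQ_Suc[OF lim_const_over_n])
  ultimately show "0 \<le> pre_nsq (kmean K) R"
    by (intro LIMSEQ_le_const[of _ "pre_nsq (kmean K) R" 0]) auto
qed

lemma dirac_approximation:
  assumes L: "snd ` set L \<subseteq> prob_measures M"
  obtains r where "\<And>n. snd ` set (r n) \<subseteq> space M"
    and "(\<lambda>n. pre_nsq (kmean K) (pre_diff (dirac_comb M (r n)) L)) \<longlonglongrightarrow> 0"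
proof -
  define C where "C = 2 * B * (\<Sum>(c,\<mu>)\<leftarrow>L. c\<^sup>2)"
  have "\<exists>r. snd ` set r \<subseteq> space M \<and> pre_nsq (kmean K) (pre_diff (dirac_comb M r) L) \<le> C / real (Suc n)" for n
  proof -
    \<comment> \<open>The start \<open>pre_scale (-1) L @ L\<close> has square norm zero, so only
      the error \<open>C / real (Suc n)\<close> is left.\<close>
    obtain r where r: "snd ` set r \<subseteq> space M"
      "pre_nsq (kmean K) (pre_scale (-1) L @ dirac_comb M r)
        \<le> pre_nsq (kmean K) (pre_scale (-1) L @ L) + C / real (Suc n)"
      using replace_all_by_points[of "pre_scale (-1) L" L "Suc n"] L by (auto simp: C_def)
    then have "pre_nsq (kmean K) (pre_diff (dirac_comb M r) L) \<le> C / real (Suc n)"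
      by (simp add: pre_nsq_eq_ip)
    with r show ?thesis by blast
  qed
  then obtain r where r: "\<And>n. snd ` set (r n) \<subseteq> space M"
    and le: "\<And>n. pre_nsq (kmean K) (pre_diff (dirac_comb M (r n)) L) \<le> C / real (Suc n)"
    by metis
  have "(\<lambda>n. pre_nsq (kmean K) (pre_diff (dirac_comb M (r n)) L)) \<longlonglongrightarrow> 0"
  proof (rule tendsto_sandwich[OF _ _ tendsto_const])
    show "(\<lambda>n. C / real (Suc n)) \<longlonglongrightarrow> 0"
      by (rule LIMSEQ_Suc[OF lim_const_over_n])
    show "\<forall>\<^sub>F n in sequentially. 0 \<le> pre_nsq (kmean K) (pre_diff (dirac_comb M (r n)) L)"
      by (intro always_eventually allI ms.nonneg) (use snd_set_dirac_comb[OF r] L in simp)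
  qed (use le in auto)
  with r that show thesis by blast
qed

text \<open>The function \<open>f\<close> is represented by the combination \<open>L\<close> of
  measures. Point combinations close to \<open>L\<close> show membership. For the norm, the sequence
  chosen by the definition differs from them by a null sequence, hence also tends to
  \<open>L\<close>, and square norms are continuous.\<close>

theorem mean_embedding_in_rkhs:
  assumes L: "snd ` set L \<subseteq> prob_measures M"
    and f: "\<And>z. z \<in> space M \<Longrightarrow> f z = (\<Sum>(c,\<mu>)\<leftarrow>L. c * (\<integral>x. K x z \<partial>\<mu>))"
  shows "in_rkhs (space M) K f" "rkhs_norm_sq (space M) K f = pre_nsq (kmean K) L"
proof -
  let ?Q = "pre_nsq (kmean K)" and ?D = "dirac_comb M"
  \<comment> \<open>Evaluation at \<open>z\<close> is the inner product with the point mass at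
    \<open>z\<close>, so norm convergence to \<open>L\<close> gives the pointwise convergence that
    \<open>rkhs_approx\<close> asks for.\<close>
  have f_eval: "f z = pre_ip (kmean K) L (?D [(1,z)])" if z: "z \<in> space M" for z
  proof -
    have "(\<integral>x. K x z \<partial>\<mu>) = kmean K \<mu> (return M z)" if "\<mu> \<in> prob_measures M" for \<mu>
      unfolding kmean_return_right[OF that z]
      using z prob_measuresD(3)[OF that] by (intro Bochner_Integration.integral_cong refl pt.sym) auto
    then have "map (\<lambda>(c,\<mu>). c * (\<integral>x. K x z \<partial>\<mu>)) L = map (\<lambda>(c,\<mu>). c * kmean K \<mu> (return M z)) L"
      using L by (intro map_cong) auto
    then have "f z = pre_eval (kmean K) L (return M z)"
      unfolding f[OF z] pre_eval_def by (rule arg_cong[where f=sum_list])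
    then show ?thesis
      by (simp add: pre_eval_eq_ip dirac_comb_def)
  qed
  obtain r where r: "\<And>n. snd ` set (r n) \<subseteq> space M"
    and lim: "(\<lambda>n. ?Q (pre_diff (?D (r n)) L)) \<longlonglongrightarrow> 0"
    by (rule dirac_approximation[OF L], rule that)
  have Dr: "\<And>n. snd ` set (?D (r n)) \<subseteq> prob_measures M"
    by (rule snd_set_dirac_comb[OF r])
  have diff: "pre_nsq K (pre_diff s s') = ?Q (pre_diff (?D s) (?D s'))"
    if "snd ` set s \<subseteq> space M" "snd ` set s' \<subseteq> space M" for s s'
    using that by (simp add: pre_nsq_eq_ip pre_ip_dirac_comb)
  have approx: "rkhs_approx (space M) K f r"
    unfolding rkhs_approx_def
  proof (intro conjI allI impI ballI)
    fix e :: real assume e: "0 < e"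
    from LIMSEQ_D[OF lim, of "e / 4"] e obtain N where N: "\<And>n. n \<ge> N \<Longrightarrow> ?Q (pre_diff (?D (r n)) L) < e / 4"
      by force
    show "\<exists>N. \<forall>n\<ge>N. \<forall>n'\<ge>N. pre_nsq K (pre_diff (r n) (r n')) < e"
    proof (intro exI allI impI)
      fix n n' assume "N \<le> n" "N \<le> n'"
      with N[of n] N[of n'] show "pre_nsq K (pre_diff (r n) (r n')) < e"
        using ms.nsq_diff_triangle[OF Dr[of n] Dr[of n'] L] diff[OF r r] by simp
    qed
  next
    fix z assume z: "z \<in> space M"
    have "(\<lambda>n. pre_ip (kmean K) (?D (r n)) (?D [(1,z)])) \<longlonglongrightarrow> pre_ip (kmean K) L (?D [(1,z)])"
      using z by (intro ms.ip_tendsto[OF Dr L _ lim] snd_set_dirac_comb) auto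
    then show "(\<lambda>n. pre_eval K (r n) z) \<longlonglongrightarrow> f z"
      using z r by (simp add: f_eval pre_ip_dirac_comb pre_eval_eq_ip)
  qed (rule r)
  then show "in_rkhs (space M) K f"
    unfolding in_rkhs_def by blast
  define r' where "r' = (SOME r. rkhs_approx (space M) K f r)"
  have r': "rkhs_approx (space M) K f r'"
    unfolding r'_def by (rule someI[of _ r]) (rule approx)
  have r'S: "\<And>n. snd ` set (r' n) \<subseteq> space M"
    using r' by (simp add: rkhs_approx_def)
  have Dr': "\<And>n. snd ` set (?D (r' n)) \<subseteq> prob_measures M"
    by (rule snd_set_dirac_comb[OF r'S])
  have "(\<lambda>n. ?Q (pre_diff (?D (r' n)) L)) \<longlonglongrightarrow> 0"
  proof (rule tendsto_sandwich[OF _ _ tendsto_const])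
    have "(\<lambda>n. 2 * pre_nsq K (pre_diff (r' n) (r n)) + 2 * ?Q (pre_diff (?D (r n)) L)) \<longlonglongrightarrow> 2 * 0 + 2 * 0"
      by (intro tendsto_intros lim pt.rkhs_approx_unique[OF r' approx])
    then show "(\<lambda>n. 2 * pre_nsq K (pre_diff (r' n) (r n)) + 2 * ?Q (pre_diff (?D (r n)) L)) \<longlonglongrightarrow> 0"
      by simp
    show "\<forall>\<^sub>F n in sequentially. ?Q (pre_diff (?D (r' n)) L)
        \<le> 2 * pre_nsq K (pre_diff (r' n) (r n)) + 2 * ?Q (pre_diff (?D (r n)) L)"
      using ms.nsq_diff_triangle[OF Dr' L Dr] ms.nsq_diff_commute[OF L Dr]
      by (intro always_eventually allI) (simp add: diff r r'S)
    show "\<forall>\<^sub>F n in sequentially. 0 \<le> ?Q (pre_diff (?D (r' n)) L)"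
      by (intro always_eventually allI ms.nonneg) (use Dr' L in simp)
  qed
  from ms.nsq_tendsto[OF Dr' L this]
  have "(\<lambda>n. pre_nsq K (r' n)) \<longlonglongrightarrow> ?Q L"
    by (simp add: pre_nsq_dirac_comb[OF r'S])
  then show "rkhs_norm_sq (space M) K f = ?Q L"
    unfolding rkhs_norm_sq_def r'_def[symmetric] by (rule limI)
qed

end

section \<open>Borel sets of Polish spaces\<close>

lemma space_borel_of [simp]: "space (borel_of X) = topspace X"
  and sets_borel_of: "sets (borel_of X) = sigma_sets (topspace X) {U. openin X U}"
  unfolding borel_of_def by (auto intro!: space_measure_of sets_measure_of dest: openin_subset)

lemma openin_sets_borel_of: "openin X U \<Longrightarrow> U \<in> sets (borel_of X)"
  by (auto simp: sets_borel_of)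

lemma closedin_sets_borel_of:
  assumes "closedin X C"
  shows "C \<in> sets (borel_of X)"
proof -
  have "topspace X - (topspace X - C) \<in> sets (borel_of X)"
    using assms sets.compl_sets[OF openin_sets_borel_of] by (metis openin_diff openin_topspace space_borel_of)
  then show ?thesis
    using closedin_subset[OF assms] by (simp add: double_diff)
qed

lemma continuous_map_measurable:
  assumes "continuous_map X euclideanreal f"
  shows "f \<in> borel_measurable (borel_of X)"
proof (rule borel_measurableI)
  fix S :: "real set" assume "open S"
  then have "openin X {x \<in> topspace X. f x \<in> S}"
    using openin_continuous_map_preimage[OF assms] by simp
  moreover have "f -` S \<inter> space (borel_of X) = {x \<in> topspace X. f x \<in> S}"
    by auto
  ultimately show "f -` S \<inter> space (borel_of X) \<in> sets (borel_of X)"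
    using openin_sets_borel_of by simp
qed

section \<open>Second countability and measurability of continuous kernels\<close>

lemma Polish_imp_second_countable:
  assumes "Polish X"
  shows "second_countable X"
proof -
  obtain M d where md: "Metric_space M d" and X: "X = Metric_space.mtopology M d"
    using assms by (auto simp: Polish_def completely_metrizable_space_def)
  interpret Metric_space M d by (rule md)
  obtain C where C: "countable C" "C \<subseteq> M" "mtopology closure_of C = M"
    using assms by (auto simp: Polish_def separable_space_def X)
  define \<B> where "\<B> = (\<lambda>(c, n). mball c (1 / real (Suc n))) ` (C \<times> UNIV)"
  show ?thesis
    unfolding second_countable_def X
  proof (intro exI conjI allI ballI impI)
    show "countable \<B>"
      unfolding \<B>_def using C(1) by auto
    show "openin mtopology V" if "V \<in> \<B>" for V
      using that by (auto simp: \<B>_def)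
    fix U x assume "openin mtopology U \<and> x \<in> U"
    then have x: "x \<in> M" and "\<exists>r>0. mball x r \<subseteq> U"
      unfolding openin_mtopology by blast+
    then obtain r where r: "r > 0" "mball x r \<subseteq> U"
      by blast
    obtain n where n: "1 / real (Suc n) < r / 2"
      using reals_Archimedean[of "r / 2"] r by (auto simp: inverse_eq_divide)
    have "x \<in> mtopology closure_of C"
      using C(3) x by simp
    then have "\<exists>y\<in>C. y \<in> mball x (1 / real (Suc n))"
      unfolding metric_closure_of by (simp del: of_nat_Suc)
    then obtain c where c: "c \<in> C" "c \<in> mball x (1 / real (Suc n))"
      by blast
    show "\<exists>V\<in>\<B>. x \<in> V \<and> V \<subseteq> U"
    proof (intro bexI conjI)
      show "x \<in> mball c (1 / real (Suc n))"
        using c by (auto simp: in_mball commute)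
      have "mball c (1 / real (Suc n)) \<subseteq> mball x r"
      proof
        fix y assume y: "y \<in> mball c (1 / real (Suc n))"
        then have "d x y \<le> d x c + d c y"
          using c x by (intro triangle) auto
        then show "y \<in> mball x r"
          using y c n by (auto simp: in_mball)
      qed
      then show "mball c (1 / real (Suc n)) \<subseteq> U"
        using r by blast
      show "mball c (1 / real (Suc n)) \<in> \<B>"
        using c by (auto simp: \<B>_def)
    qed
  qed
qed

text \<open>The kernel is continuous for the product topology, while Fubini needs measurability for
  the product sigma-algebra. Countable bases of the factors turn an open set into a countable union
  of open rectangles.\<close>

lemma openin_prod_topology_sets:
  assumes "second_countable X" "second_countable Y" and W: "openin (prod_topology X Y) W"
  shows "W \<in> sets (borel_of X \<Otimes>\<^sub>M borel_of Y)"
proof -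
  obtain \<B> where \<B>: "countable \<B>" "\<forall>V\<in>\<B>. openin X V"
    and \<B>': "\<forall>U x. openin X U \<and> x \<in> U \<longrightarrow> (\<exists>V\<in>\<B>. x \<in> V \<and> V \<subseteq> U)"
    using assms(1) unfolding second_countable_def by (elim exE conjE)
  obtain \<C> where \<C>: "countable \<C>" "\<forall>V\<in>\<C>. openin Y V"
    and \<C>': "\<forall>U x. openin Y U \<and> x \<in> U \<longrightarrow> (\<exists>V\<in>\<C>. x \<in> V \<and> V \<subseteq> U)"
    using assms(2) unfolding second_countable_def by (elim exE conjE)
  define R where "R = {(U, V) \<in> \<B> \<times> \<C>. U \<times> V \<subseteq> W}"
  have "W = (\<Union>(U, V)\<in>R. U \<times> V)"
  proof (intro equalityI subsetI)
    fix p assume p: "p \<in> W"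
    then have "(fst p, snd p) \<in> W" by simp
    then obtain U V where UV: "openin X U" "openin Y V" "fst p \<in> U" "snd p \<in> V" "U \<times> V \<subseteq> W"
      using W unfolding openin_prod_topology_alt by (elim allE impE exE conjE)
    obtain U' where U': "U' \<in> \<B>" "fst p \<in> U'" "U' \<subseteq> U"
      using \<B>'[rule_format, OF conjI[OF UV(1,3)]] by blast
    obtain V' where V': "V' \<in> \<C>" "snd p \<in> V'" "V' \<subseteq> V"
      using \<C>'[rule_format, OF conjI[OF UV(2,4)]] by blast
    have "U' \<times> V' \<subseteq> W"
      using Sigma_mono[OF U'(3) V'(3)] UV(5) by (rule order.trans)
    then have "(U', V') \<in> R" "p \<in> U' \<times> V'"
      using U' V' by (simp_all add: R_def mem_Times_iff)
    then show "p \<in> (\<Union>(U, V)\<in>R. U \<times> V)" by blast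
  qed (auto simp: R_def)
  moreover have "countable R"
    by (rule countable_subset[of _ "\<B> \<times> \<C>"]) (use \<B> \<C> in \<open>auto simp: R_def\<close>)
  then have "(\<Union>(U, V)\<in>R. U \<times> V) \<in> sets (borel_of X \<Otimes>\<^sub>M borel_of Y)"
    using \<B>(2) \<C>(2) by (intro sets.countable_UN') (auto simp: R_def intro!: pair_measureI openin_sets_borel_of)
  ultimately show ?thesis by simp
qed

lemma continuous_map_prod_measurable:
  assumes "second_countable X" "second_countable Y" "continuous_map (prod_topology X Y) euclideanreal f"
  shows "f \<in> borel_measurable (borel_of X \<Otimes>\<^sub>M borel_of Y)"
proof (rule borel_measurableI)
  fix S :: "real set" assume "open S"
  then have "openin (prod_topology X Y) {x \<in> topspace (prod_topology X Y). f x \<in> S}"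
    using openin_continuous_map_preimage[OF assms(3)] by simp
  moreover have "f -` S \<inter> space (borel_of X \<Otimes>\<^sub>M borel_of Y) = {x \<in> topspace (prod_topology X Y). f x \<in> S}"
    by (auto simp: space_pair_measure)
  ultimately show "f -` S \<inter> space (borel_of X \<Otimes>\<^sub>M borel_of Y) \<in> sets (borel_of X \<Otimes>\<^sub>M borel_of Y)"
    using openin_prod_topology_sets[OF assms(1,2)] by simp
qed

text \<open>For each point outside a compact set, finitely many separating functions suffice; by the
  Lindelof property countably many of the resulting neighbourhoods cover the complement.\<close>

lemma compactin_generated_by_separating:
  fixes F :: "('a \<Rightarrow> real) set"
  assumes sc: "second_countable X" and cont: "\<And>f. f \<in> F \<Longrightarrow> continuous_map X euclideanreal f"
    and sep: "\<And>x y. \<lbrakk>x \<in> topspace X; y \<in> topspace X; x \<noteq> y\<rbrakk> \<Longrightarrow> \<exists>f\<in>F. f x \<noteq> f y"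
    and C: "compactin X C"
    and N: "space N = topspace X" "\<And>f. f \<in> F \<Longrightarrow> f \<in> borel_measurable N"
  shows "C \<in> sets N"
proof -
  have CX: "C \<subseteq> topspace X" using C by (simp add: compactin_def)
  have pair: "\<exists>U V. openin X U \<and> openin X V \<and> U \<in> sets N \<and> x \<in> U \<and> y \<in> V \<and> U \<inter> V = {}"
    if xy: "x \<in> topspace X" "y \<in> topspace X" "x \<noteq> y" for x y
  proof -
    obtain f where f: "f \<in> F" "f x \<noteq> f y" using sep[OF xy] by blast
    \<comment> \<open>The midpoint separates the two values strictly, so \<open>x\<close> and
      \<open>y\<close> get disjoint neighbourhoods that are both open and in
      \<open>sets N\<close>.\<close>
    define m where "m = (f x + f y) / 2"
    have [measurable]: "f \<in> borel_measurable N" by (rule N(2)[OF f(1)])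
    have op: "openin X {u \<in> topspace X. f u < m}" "openin X {u \<in> topspace X. m < f u}"
      using openin_continuous_map_preimage[OF cont[OF f(1)], of "{..<m}"]
        openin_continuous_map_preimage[OF cont[OF f(1)], of "{m<..}"] by auto
    have me: "{u \<in> topspace X. f u < m} \<in> sets N" "{u \<in> topspace X. m < f u} \<in> sets N"
      unfolding N(1)[symmetric] by measurable
    show ?thesis
    proof (cases "f x < f y")
      case True
      then show ?thesis
        using op me xy by (intro exI[of _ "{u \<in> topspace X. f u < m}"] exI[of _ "{u \<in> topspace X. m < f u}"])
          (auto simp: m_def)
    next
      case False
      then show ?thesis
        using op me xy f(2) by (intro exI[of _ "{u \<in> topspace X. m < f u}"] exI[of _ "{u \<in> topspace X. f u < m}"])
          (auto simp: m_def)
    qed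
  qed
  have nbhd: "\<exists>U. openin X U \<and> U \<in> sets N \<and> x \<in> U \<and> U \<inter> C = {}" if x: "x \<in> topspace X - C" for x
  proof -
    have "\<forall>y\<in>C. \<exists>U V. openin X U \<and> openin X V \<and> U \<in> sets N \<and> x \<in> U \<and> y \<in> V \<and> U \<inter> V = {}"
      using pair x CX by blast
    then obtain U V where UV: "\<And>y. y \<in> C \<Longrightarrow> openin X (U y) \<and> openin X (V y) \<and> U y \<in> sets N \<and> x \<in> U y
        \<and> y \<in> V y \<and> U y \<inter> V y = {}"
      by metis
    have "(\<forall>W\<in>V ` C. openin X W) \<and> C \<subseteq> \<Union>(V ` C)"
      using UV by blast
    then obtain \<F> where "finite \<F>" "\<F> \<subseteq> V ` C" "C \<subseteq> \<Union>\<F>"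
      using C unfolding compactin_def by meson
    then obtain J where J: "finite J" "J \<subseteq> C" "C \<subseteq> \<Union>(V ` J)"
      by (metis finite_subset_image)
    \<comment> \<open>The empty intersection would be the whole type and not
      \<open>topspace X\<close>; \<open>J\<close> is empty exactly when \<open>C\<close> is.\<close>
    define W where "W = (if J = {} then topspace X else (\<Inter>y\<in>J. U y))"
    have "openin X W"
      unfolding W_def using J UV openin_Inter[of "U ` J" X] by auto
    moreover have "W \<in> sets N"
      unfolding W_def using J UV N(1) sets.top[of N] by (auto intro!: sets.finite_INT)
    moreover have "x \<in> W"
      unfolding W_def using J UV x by auto
    moreover have "W \<inter> C = {}"
    proof (rule ccontr)
      assume "W \<inter> C \<noteq> {}"
      then obtain y w where y: "y \<in> J" "w \<in> V y" "w \<in> W" using J(3) by blast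
      then have "w \<in> U y" unfolding W_def by (auto split: if_splits)
      then show False using UV[of y] y J(2) by blast
    qed
    ultimately show ?thesis by blast
  qed
  define \<U> where "\<U> = {U. openin X U \<and> U \<in> sets N \<and> U \<inter> C = {}}"
  have "Lindelof_space (subtopology X (topspace X - C))"
    by (intro second_countable_imp_Lindelof_space second_countable_subtopology sc)
  moreover have "(\<forall>U\<in>\<U>. openin X U) \<and> topspace X - C \<subseteq> \<Union>\<U>"
    using nbhd by (auto simp: \<U>_def)
  ultimately obtain \<V> where \<V>: "countable \<V>" "\<V> \<subseteq> \<U>" "topspace X - C \<subseteq> \<Union>\<V>"
    unfolding Lindelof_space_subtopology_subset[OF Diff_subset] by meson
  have "U \<subseteq> topspace X - C" if "U \<in> \<V>" for U
  proof -
    have "openin X U" "U \<inter> C = {}" using that \<V>(2) by (auto simp: \<U>_def)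
    then show ?thesis using openin_subset[of X U] by blast
  qed
  then have "\<Union>\<V> = topspace X - C"
    using \<V>(3) by blast
  moreover have "\<Union>\<V> \<in> sets N"
    using \<V> by (intro sets.countable_Union) (auto simp: \<U>_def)
  ultimately have "space N - (topspace X - C) \<in> sets N"
    by auto
  then show ?thesis
    using CX by (simp add: N(1) double_diff)
qed

section \<open>Tightness of Borel probability measures\<close>

lemma (in Metric_space) compactin_Inter_finite_cballs:
  assumes "mcomplete" and F: "\<And>k. finite (F k)" "\<And>k. F k \<subseteq> M"
  shows "compactin mtopology (M \<inter> (\<Inter>k. \<Union>c\<in>F k. mcball c (1 / real (Suc k))))"
proof -
  let ?C = "M \<inter> (\<Inter>k. \<Union>c\<in>F k. mcball c (1 / real (Suc k)))"
  have clo: "closedin mtopology ?C"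
  proof -
    have "closedin mtopology (\<Inter>k. \<Union>c\<in>F k. mcball c (1 / real (Suc k)))"
      using F by (intro closedin_INT closedin_Union) auto
    moreover have "?C = (\<Inter>k. \<Union>c\<in>F k. mcball c (1 / real (Suc k)))"
      by auto
    ultimately show ?thesis by simp
  qed
  \<comment> \<open>Finitely many balls of radius \<open>1 / real (Suc k)\<close> cover the set for
    every \<open>k\<close>; by completeness its closure, which is the set itself, is
    compact.\<close>
  have "mtotally_bounded ?C"
    unfolding mtotally_bounded_def
  proof (intro allI impI)
    fix e :: real assume e: "0 < e"
    obtain k where k: "1 / real (Suc k) < e / 2"
      using reals_Archimedean[of "e / 2"] e by (auto simp: inverse_eq_divide)
    \<comment> \<open>The centres in \<open>F k\<close> may lie outside the set, but total
      boundedness asks for centres inside. Each ball that meets the set gets a new centre there,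
      which doubles the radius; hence \<open>e / 2\<close>.\<close>
    define G where "G = {c \<in> F k. mcball c (1 / real (Suc k)) \<inter> ?C \<noteq> {}}"
    have "\<forall>c\<in>G. \<exists>p. p \<in> mcball c (1 / real (Suc k)) \<inter> ?C"
      unfolding G_def by blast
    then obtain p where p: "\<And>c. c \<in> G \<Longrightarrow> p c \<in> mcball c (1 / real (Suc k)) \<inter> ?C"
      by metis
    have "?C \<subseteq> (\<Union>x\<in>p ` G. mball x e)"
    proof
      fix x assume x: "x \<in> ?C"
      then obtain c where c: "c \<in> F k" "x \<in> mcball c (1 / real (Suc k))" by blast
      then have cG: "c \<in> G" using x unfolding G_def by blast
      from p[OF this] have "p c \<in> mcball c (1 / real (Suc k))" by blast
      then have pc: "p c \<in> M" "d c (p c) \<le> 1 / real (Suc k)" "c \<in> M"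
        by (auto simp: in_mcball)
      have xc: "x \<in> M" "d c x \<le> 1 / real (Suc k)"
        using c by (auto simp: in_mcball)
      have "d (p c) x \<le> d (p c) c + d c x"
        using pc xc by (intro triangle) auto
      then have "d (p c) x < e"
        using pc xc k by (simp add: commute)
      then show "x \<in> (\<Union>x\<in>p ` G. mball x e)"
        using cG pc xc by (auto simp: in_mball)
    qed
    moreover have "finite (p ` G)"
      using F(1)[of k] by (simp add: G_def)
    moreover have "p ` G \<subseteq> ?C"
      using p by blast
    ultimately show "\<exists>K. finite K \<and> K \<subseteq> ?C \<and> ?C \<subseteq> (\<Union>x\<in>K. mball x e)" by blast
  qed
  then have "compactin mtopology (mtopology closure_of ?C)"
    unfolding mtotally_bounded_eq_compact_closure_of[OF assms(1)] by (rule conjunct2)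
  then show ?thesis
    unfolding closure_of_closedin[OF clo] .
qed

text \<open>Ulam's theorem. At each scale, finitely many balls about a dense sequence miss at most
  \<open>e * (1/2) ^ Suc k\<close> of the mass; these losses sum to \<open>e\<close>, and
  intersecting over all scales leaves a compact set.\<close>

lemma Polish_tight:
  assumes "Polish X" "prob_space \<mu>" and sets: "sets \<mu> = sets (borel_of X)" and e: "0 < (e::real)"
  shows "\<exists>C. compactin X C \<and> measure \<mu> (space \<mu> - C) \<le> e"
proof -
  interpret prob_space \<mu> by fact
  obtain M d where md: "Metric_space M d" "Metric_space.mcomplete M d" and X: "X = Metric_space.mtopology M d"
    using assms(1) by (auto simp: Polish_def completely_metrizable_space_def)
  interpret Metric_space M d by (rule md)
  have sp: "space \<mu> = M"
    using sets_eq_imp_space_eq[OF sets] by (simp add: X)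
  obtain D where D: "countable D" "D \<subseteq> M" "mtopology closure_of D = M"
    using assms(1) by (auto simp: Polish_def separable_space_def X)
  have "M \<noteq> {}" using not_empty sp by simp
  then have "D \<noteq> {}" using D(3) by auto
  define q where "q = from_nat_into D"
  have q: "range q = D"
    unfolding q_def by (rule range_from_nat_into[OF \<open>D \<noteq> {}\<close> D(1)])
  have qM: "q i \<in> M" for i using q D(2) by blast
  define A where "A k n = (\<Union>i\<le>n. mcball (q i) (1 / real (Suc k)))" for k n :: nat
  have A_sets: "A k n \<in> events" for k n
  proof -
    have "closedin mtopology (A k n)"
      unfolding A_def by (intro closedin_Union) auto
    then show ?thesis
      using closedin_sets_borel_of sets X by blast
  qed
  have A_cover: "(\<Union>n. A k n) = M" for k
  proof
    show "(\<Union>n. A k n) \<subseteq> M" by (auto simp: A_def)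
    show "M \<subseteq> (\<Union>n. A k n)"
    proof
      fix x assume "x \<in> M"
      then have "x \<in> mtopology closure_of D" using D by simp
      then have "\<exists>y\<in>D. y \<in> mball x (1 / real (Suc k))"
        unfolding metric_closure_of by (simp del: of_nat_Suc)
      then obtain c where c: "c \<in> D" "c \<in> mball x (1 / real (Suc k))" by blast
      then obtain i where "c = q i" using q by blast
      then have "x \<in> mcball (q i) (1 / real (Suc k))"
        using c(2) by (simp add: in_mball in_mcball commute)
      then have "x \<in> A k i"
        unfolding A_def by blast
      then show "x \<in> (\<Union>n. A k n)" by blast
    qed
  qed
  have "\<exists>n. 1 - e * (1/2) ^ Suc k < prob (A k n)" for k
  proof -
    have "incseq (A k)"
      unfolding A_def by (intro incseq_SucI UN_mono) auto
    then have "(\<lambda>n. prob (A k n)) \<longlonglongrightarrow> prob (\<Union>n. A k n)"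
      using A_sets by (intro finite_Lim_measure_incseq) auto
    then have "(\<lambda>n. prob (A k n)) \<longlonglongrightarrow> 1"
      unfolding A_cover using prob_space sp by simp
    then have "\<forall>\<^sub>F n in sequentially. 1 - e * (1/2) ^ Suc k < prob (A k n)"
      by (rule order_tendstoD) (use e in simp)
    then show ?thesis by (meson eventually_happens sequentially_bot)
  qed
  then obtain n where n: "\<And>k. 1 - e * (1/2) ^ Suc k < prob (A k (n k))" by metis
  define C where "C = M \<inter> (\<Inter>k. A k (n k))"
  have C_eq: "C = M \<inter> (\<Inter>k. \<Union>c\<in>q ` {..n k}. mcball c (1 / real (Suc k)))"
    by (auto simp: C_def A_def)
  have "compactin X C"
    unfolding C_eq X using qM by (intro compactin_Inter_finite_cballs[OF md(2)]) auto
  moreover have "prob (space \<mu> - C) \<le> e"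
  proof -
    have half: "(\<lambda>k. e * (1/2) ^ Suc k) sums e"
      using sums_mult[OF power_half_series, of e] by simp
    have compl: "prob (space \<mu> - A k (n k)) \<le> e * (1/2) ^ Suc k" for k
      using n[of k] prob_compl[OF A_sets] by (simp add: less_imp_le)
    have sm: "summable (\<lambda>k. prob (space \<mu> - A k (n k)))"
      by (rule summable_comparison_test[OF _ sums_summable[OF half]]) (use compl in auto)
    have "prob (space \<mu> - C) = prob (\<Union>k. space \<mu> - A k (n k))"
      by (rule arg_cong[where f=prob]) (auto simp: C_def sp)
    also have "\<dots> \<le> (\<Sum>k. prob (space \<mu> - A k (n k)))"
      using A_sets by (intro finite_measure_subadditive_countably sm) auto
    also have "\<dots> \<le> (\<Sum>k. e * (1/2) ^ Suc k)"
      by (intro suminf_le compl sm sums_summable[OF half])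
    also have "\<dots> = e" using half by (rule sums_unique[symmetric])
    finally show ?thesis .
  qed
  ultimately show ?thesis by blast
qed

text \<open>Tightness with the errors \<open>1 / real (Suc n)\<close> leaves a null set outside the
  union, although no single compact set need have full measure.\<close>

lemma Polish_sigma_compact_support:
  assumes "Polish X" "prob_space \<mu>" and sets: "sets \<mu> = sets (borel_of X)"
  obtains C :: "nat \<Rightarrow> 'a set" where "\<And>n. compactin X (C n)" and "AE x in \<mu>. x \<in> (\<Union>n. C n)"
proof -
  interpret prob_space \<mu> by fact
  have "\<exists>C. compactin X C \<and> prob (space \<mu> - C) \<le> 1 / real (Suc n)" for n
    by (rule Polish_tight[OF assms]) simp
  then obtain C where C: "\<And>n. compactin X (C n)" "\<And>n. prob (space \<mu> - C n) \<le> 1 / real (Suc n)"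
    by metis
  have "Hausdorff_space X"
    using assms(1) unfolding Polish_def
    by (meson completely_metrizable_imp_metrizable_space metrizable_imp_Hausdorff_space)
  then have C_sets: "C n \<in> events" for n
    using closedin_sets_borel_of[OF compactin_imp_closedin[OF _ C(1)]] sets by simp
  have "prob (space \<mu> - (\<Union>n. C n)) \<le> 1 / real (Suc n)" for n
    using C_sets by (intro order.trans[OF finite_measure_mono C(2)[of n]]) auto
  moreover have "(\<lambda>n. 1 / real (Suc n)) \<longlonglongrightarrow> 0"
    by (rule LIMSEQ_Suc[OF lim_const_over_n])
  ultimately have "prob (space \<mu> - (\<Union>n. C n)) \<le> 0"
    by (intro LIMSEQ_le_const[of "\<lambda>n. 1 / real (Suc n)" 0]) auto
  then have "prob (space \<mu> - (\<Union>n. C n)) = 0"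
    using measure_nonneg by (intro antisym)
  then have "AE x in \<mu>. x \<in> (\<Union>n. C n)"
    using C_sets by (intro AE_I[where N="space \<mu> - (\<Union>n. C n)"]) (auto simp: emeasure_eq_measure)
  with C(1) that show thesis by blast
qed

section \<open>Multiplicative classes of functions determine measures\<close>

text \<open>Agreement on \<open>h \<cdot> g\<^sup>n\<close> for all \<open>n\<close> passes to \<open>h \<cdot> p(g)\<close> for polynomials \<open>p\<close>, then by uniform
  approximation to continuous \<open>p\<close>, then by dominated convergence to indicators of half-lines.\<close>

lemma integral_continuous_eq_if_powers_eq:
  fixes h g :: "'b \<Rightarrow> real" and \<phi> :: "real \<Rightarrow> real"
  assumes \<mu>: "prob_space \<mu>" and \<nu>: "prob_space \<nu>" "sets \<nu> = sets \<mu>"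
    and [measurable]: "h \<in> borel_measurable \<mu>" "g \<in> borel_measurable \<mu>"
    and h: "\<And>x. x \<in> space \<mu> \<Longrightarrow> \<bar>h x\<bar> \<le> A" and g: "\<And>x. x \<in> space \<mu> \<Longrightarrow> \<bar>g x\<bar> \<le> B"
    and eq: "\<And>n. (\<integral>x. h x * g x ^ n \<partial>\<mu>) = (\<integral>x. h x * g x ^ n \<partial>\<nu>)"
    and \<phi>: "continuous_on UNIV \<phi>"
  shows "(\<integral>x. h x * \<phi> (g x) \<partial>\<mu>) = (\<integral>x. h x * \<phi> (g x) \<partial>\<nu>)"
proof -
  interpret \<mu>: prob_space \<mu> by fact
  interpret \<nu>: prob_space \<nu> by fact
  have sp: "space \<nu> = space \<mu>" using \<nu>(2) by (rule sets_eq_imp_space_eq)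
  have meas_\<nu>: "f \<in> borel_measurable \<nu> \<longleftrightarrow> f \<in> borel_measurable \<mu>" for f :: "'b \<Rightarrow> real"
    using \<nu>(2) by (simp cong: measurable_cong_sets)
  have A0: "0 \<le> A" using \<mu>.not_empty h by fastforce
  have int: "integrable \<mu> (\<lambda>x. h x * f (g x))" "integrable \<nu> (\<lambda>x. h x * f (g x))"
    if f: "continuous_on UNIV f" for f :: "real \<Rightarrow> real"
  proof -
    have [measurable]: "f \<in> borel_measurable borel"
      by (rule borel_measurable_continuous_onI[OF f])
    have "bounded (f ` {-B..B})"
      by (intro compact_imp_bounded compact_continuous_image continuous_on_subset[OF f]) auto
    then obtain C where "\<forall>z\<in>f ` {-B..B}. norm z \<le> C"
      unfolding bounded_iff by blast
    then have C: "\<bar>f y\<bar> \<le> C" if "y \<in> {-B..B}" for y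
      using that by simp
    have bd: "norm (h x * f (g x)) \<le> A * C" if "x \<in> space \<mu>" for x
      unfolding real_norm_def abs_mult
      using h[OF that] g[OF that] C[of "g x"] A0 by (intro mult_mono) (auto simp: abs_le_iff)
    show "integrable \<mu> (\<lambda>x. h x * f (g x))"
      by (rule \<mu>.integrable_const_bound[where B="A * C"]) (use bd in auto)
    show "integrable \<nu> (\<lambda>x. h x * f (g x))"
      by (rule \<nu>.integrable_const_bound[where B="A * C"]) (use bd sp in \<open>auto simp: meas_\<nu>\<close>)
  qed
  have close: "\<bar>(\<integral>x. h x * \<phi> (g x) \<partial>M) - (\<integral>x. h x * p (g x) \<partial>M)\<bar> \<le> A * e"
    if M: "prob_space M" "space M = space \<mu>" "integrable M (\<lambda>x. h x * \<phi> (g x))" "integrable M (\<lambda>x. h x * p (g x))"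
      and p: "\<And>y. y \<in> {-B..B} \<Longrightarrow> \<bar>\<phi> y - p y\<bar> < e" for M p e
  proof -
    interpret M: prob_space M by (rule M(1))
    have "\<bar>(\<integral>x. h x * \<phi> (g x) \<partial>M) - (\<integral>x. h x * p (g x) \<partial>M)\<bar> = \<bar>\<integral>x. h x * \<phi> (g x) - h x * p (g x) \<partial>M\<bar>"
      using M by simp
    also have "\<dots> \<le> (\<integral>x. \<bar>h x * \<phi> (g x) - h x * p (g x)\<bar> \<partial>M)"
      by (rule integral_abs_bound)
    also have "\<dots> \<le> (\<integral>x. A * e \<partial>M)"
    proof (rule integral_mono)
      fix x assume x: "x \<in> space M"
      have "\<bar>h x * \<phi> (g x) - h x * p (g x)\<bar> = \<bar>h x\<bar> * \<bar>\<phi> (g x) - p (g x)\<bar>"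
        by (simp add: abs_mult[symmetric] right_diff_distrib)
      also have "\<dots> \<le> A * e"
        using h[of x] g[of x] x M(2) p[of "g x"] A0 by (intro mult_mono) (auto simp: abs_le_iff)
      finally show "\<bar>h x * \<phi> (g x) - h x * p (g x)\<bar> \<le> A * e" .
    qed (use M in auto)
    finally show ?thesis by (simp add: M.prob_space)
  qed
  define D where "D = \<bar>(\<integral>x. h x * \<phi> (g x) \<partial>\<mu>) - (\<integral>x. h x * \<phi> (g x) \<partial>\<nu>)\<bar>"
  have "D \<le> 2 * A * e" if e: "0 < e" for e
  proof -
    obtain p where p: "polynomial_function p" "\<forall>y\<in>{-B..B}. norm (\<phi> y - p y) < e"
      using Stone_Weierstrass_polynomial_function[of "{-B..B}" \<phi> e] continuous_on_subset[OF \<phi>] e by auto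
    then have p': "\<And>y. y \<in> {-B..B} \<Longrightarrow> \<bar>\<phi> y - p y\<bar> < e" by auto
    from p(1) obtain a n where pa: "p = (\<lambda>y. \<Sum>i\<le>n. a i * y ^ i)"
      using real_polynomial_function_eq real_polynomial_function_iff_sum by metis
    have pw: "integrable \<mu> (\<lambda>x. h x * g x ^ i)" "integrable \<nu> (\<lambda>x. h x * g x ^ i)" for i
      using int[of "\<lambda>y. y ^ i"] continuous_on_power[OF continuous_on_id, of UNIV i] by auto
    have hp: "h x * p (g x) = (\<Sum>i\<le>n. a i * (h x * g x ^ i))" for x
      by (simp add: pa sum_distrib_left algebra_simps)
    have "(\<integral>x. h x * p (g x) \<partial>\<mu>) = (\<integral>x. h x * p (g x) \<partial>\<nu>)"
      unfolding hp using pw eq by simp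
    moreover have cp: "continuous_on UNIV p"
      unfolding pa by (intro continuous_intros)
    ultimately show ?thesis
      using close[OF \<mu> refl int(1)[OF \<phi>] int(1)[OF cp] p'] close[OF \<nu>(1) sp int(2)[OF \<phi>] int(2)[OF cp] p']
      unfolding D_def by (auto simp: abs_le_iff)
  qed
  have "D \<le> 0"
  proof (rule field_le_epsilon)
    fix e :: real assume e: "0 < e"
    \<comment> \<open>Since \<open>A\<close> may be zero, the denominator is
      \<open>2 * A + 1\<close>.\<close>
    have "D \<le> 2 * A * (e / (2 * A + 1))"
      using e A0 by (intro \<open>\<And>e. 0 < e \<Longrightarrow> D \<le> 2 * A * e\<close>) auto
    also have "\<dots> \<le> e"
      using e A0 by (simp add: field_simps)
    finally show "D \<le> 0 + e" by simp
  qed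
  then show ?thesis by (simp add: D_def)
qed

text \<open>The factor \<open>h\<close> is an arbitrary bounded measurable function, so it may
  already contain indicators; half-line conditions can thus be imposed on one function after
  another.\<close>

lemma integral_indicator_eq_if_powers_eq:
  fixes h g :: "'b \<Rightarrow> real"
  assumes \<mu>: "prob_space \<mu>" and \<nu>: "prob_space \<nu>" "sets \<nu> = sets \<mu>"
    and [measurable]: "h \<in> borel_measurable \<mu>" "g \<in> borel_measurable \<mu>"
    and h: "\<And>x. x \<in> space \<mu> \<Longrightarrow> \<bar>h x\<bar> \<le> A" and g: "\<And>x. x \<in> space \<mu> \<Longrightarrow> \<bar>g x\<bar> \<le> B"
    and eq: "\<And>n. (\<integral>x. h x * g x ^ n \<partial>\<mu>) = (\<integral>x. h x * g x ^ n \<partial>\<nu>)"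
  shows "(\<integral>x. h x * indicator {a<..} (g x) \<partial>\<mu>) = (\<integral>x. h x * indicator {a<..} (g x) \<partial>\<nu>)"
proof -
  interpret \<mu>: prob_space \<mu> by fact
  interpret \<nu>: prob_space \<nu> by fact
  have sp: "space \<nu> = space \<mu>" using \<nu>(2) by (rule sets_eq_imp_space_eq)
  have A0: "0 \<le> A" using \<mu>.not_empty h by fastforce
  \<comment> \<open>Continuous ramps, zero up to \<open>a\<close> and, for positive
    \<open>n\<close>, one from \<open>a + 1 / n\<close> on. Vanishing at \<open>a\<close> itself
    makes their limit the indicator of the open half-line.\<close>
  define \<phi> :: "nat \<Rightarrow> real \<Rightarrow> real" where "\<phi> n y = min 1 (max 0 (real n * (y - a)))" for n y
  have cont: "continuous_on UNIV (\<phi> n)" for n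
    unfolding \<phi>_def by (intro continuous_intros)
  have [measurable]: "\<phi> n \<in> borel_measurable borel" for n
    by (rule borel_measurable_continuous_onI[OF cont])
  have lim: "(\<lambda>n. \<phi> n y) \<longlonglongrightarrow> indicator {a<..} y" for y
  proof (cases "a < y")
    case True
    obtain N where N: "1 < real N * (y - a)"
      using reals_Archimedean3[of "y - a"] True by auto
    have "\<phi> n y = 1" if "n \<ge> N" for n
    proof -
      have "real N * (y - a) \<le> real n * (y - a)"
        using that True by (intro mult_right_mono) auto
      then show ?thesis using N by (simp add: \<phi>_def)
    qed
    then have "\<forall>\<^sub>F n in sequentially. \<phi> n y = 1"
      unfolding eventually_sequentially by blast
    then show ?thesis
      using True by (simp add: tendsto_eventually)
  next
    case False
    then have "real n * (y - a) \<le> 0" for n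
      by (intro mult_nonneg_nonpos) auto
    then have "\<phi> n y = 0" for n
      by (simp add: \<phi>_def max_absorb1)
    then show ?thesis using False by simp
  qed
  have \<phi>1: "\<bar>\<phi> n y\<bar> \<le> 1" for n y by (simp add: \<phi>_def)
  have conv: "(\<lambda>n. \<integral>x. h x * \<phi> n (g x) \<partial>M) \<longlonglongrightarrow> (\<integral>x. h x * indicator {a<..} (g x) \<partial>M)"
    if M: "prob_space M" "sets M = sets \<mu>" for M
  proof -
    interpret M: prob_space M by (rule M(1))
    have spM: "space M = space \<mu>" using M(2) by (rule sets_eq_imp_space_eq)
    have [measurable]: "h \<in> borel_measurable M" "g \<in> borel_measurable M"
      using M(2) by (simp_all cong: measurable_cong_sets)
    show ?thesis
    proof (rule integral_dominated_convergence[where w="\<lambda>_. A"])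
      show "AE x in M. (\<lambda>n. h x * \<phi> n (g x)) \<longlonglongrightarrow> h x * indicator {a<..} (g x)"
        by (intro AE_I2 tendsto_intros lim)
      show "AE x in M. norm (h x * \<phi> n (g x)) \<le> A" for n
      proof (rule AE_I2)
        fix x assume "x \<in> space M"
        then have "\<bar>h x\<bar> * \<bar>\<phi> n (g x)\<bar> \<le> A * 1"
          using h spM \<phi>1 A0 by (intro mult_mono) auto
        then show "norm (h x * \<phi> n (g x)) \<le> A" by (simp add: abs_mult)
      qed
    qed auto
  qed
  have "(\<integral>x. h x * \<phi> n (g x) \<partial>\<mu>) = (\<integral>x. h x * \<phi> n (g x) \<partial>\<nu>)" for n
    by (rule integral_continuous_eq_if_powers_eq[OF \<mu> \<nu> _ _ h g eq cont]) auto
  with conv[OF \<mu> refl] conv[OF \<nu>] show ?thesis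
    using LIMSEQ_unique by simp
qed

text \<open>Finite intersections of superlevel sets form an intersection-stable generator, so
  Dynkin's argument extends agreement from them to \<open>S\<close>. The indicator of such an
  intersection is a product of half-line indicators, introduced one at a time.\<close>

theorem multiplicative_class_determines_measure:
  fixes H :: "('b \<Rightarrow> real) set"
  assumes \<mu>: "prob_space \<mu>" and \<nu>: "prob_space \<nu>" "sets \<nu> = sets \<mu>"
    and meas: "\<And>h. h \<in> H \<Longrightarrow> h \<in> borel_measurable \<mu>"
    and bdd: "\<And>h. h \<in> H \<Longrightarrow> \<exists>B. \<forall>x\<in>space \<mu>. \<bar>h x\<bar> \<le> B"
    and one: "(\<lambda>_. 1) \<in> H" and mult: "\<And>h g. \<lbrakk>h \<in> H; g \<in> H\<rbrakk> \<Longrightarrow> (\<lambda>x. h x * g x) \<in> H"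
    and eq: "\<And>h. h \<in> H \<Longrightarrow> (\<integral>x. h x \<partial>\<mu>) = (\<integral>x. h x \<partial>\<nu>)"
    and S: "S \<in> sigma_sets (space \<mu>) {{x \<in> space \<mu>. a < h x} | h a. h \<in> H}"
  shows "measure \<mu> S = measure \<nu> S"
proof -
  interpret \<mu>: prob_space \<mu> by fact
  interpret \<nu>: prob_space \<nu> by fact
  have sp: "space \<nu> = space \<mu>" using \<nu>(2) by (rule sets_eq_imp_space_eq)
  define R where "R ps x = (\<Prod>(g,a)\<leftarrow>ps. indicator {a<..} (g x) :: real)" for ps :: "(('b \<Rightarrow> real) \<times> real) list" and x
  define P where "P ps = {x \<in> space \<mu>. \<forall>(g,a)\<in>set ps. a < g x}" for ps :: "(('b \<Rightarrow> real) \<times> real) list"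
  have R_meas: "R ps \<in> borel_measurable \<mu>" if "fst ` set ps \<subseteq> H" for ps
    using that
  proof (induction ps)
    case (Cons p ps)
    have [measurable]: "R ps \<in> borel_measurable \<mu>" "fst p \<in> borel_measurable \<mu>"
      using Cons meas by auto
    have "R (p # ps) = (\<lambda>x. indicator {snd p<..} (fst p x) * R ps x)"
      by (auto simp: R_def case_prod_beta)
    then show ?case by simp
  qed (simp add: R_def[abs_def])
  have R_ind: "R ps x = indicator (P ps) x" if "x \<in> space \<mu>" for ps x
    using that by (induction ps) (auto simp: R_def P_def indicator_def)
  have power: "(\<lambda>x. h x * g x ^ n) \<in> H" if "h \<in> H" "g \<in> H" for h g n
  proof (induction n)
    case (Suc n)
    have "(\<lambda>x. h x * g x ^ n * g x) \<in> H" by (rule mult[OF Suc that(2)])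
    then show ?case by (simp add: algebra_simps)
  qed (use that in simp)
  \<comment> \<open>The factor \<open>h\<close> is generalised because the powers of
    \<open>g\<close> that the indicator of \<open>g\<close> calls for are absorbed into it, by
    closure of \<open>H\<close> under products.\<close>
  have key: "(\<integral>x. h x * R ps x \<partial>\<mu>) = (\<integral>x. h x * R ps x \<partial>\<nu>)" if "h \<in> H" "fst ` set ps \<subseteq> H" for h ps
    using that
  proof (induction ps arbitrary: h)
    case Nil
    then show ?case using eq by (simp add: R_def)
  next
    case (Cons p ps)
    obtain g a where p: "p = (g, a)" by force
    have gH: "g \<in> H" and ps: "fst ` set ps \<subseteq> H" using Cons.prems by (auto simp: p)
    obtain A where A: "\<And>x. x \<in> space \<mu> \<Longrightarrow> \<bar>h x\<bar> \<le> A" using bdd[OF Cons.prems(1)] by blast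
    obtain B where B: "\<And>x. x \<in> space \<mu> \<Longrightarrow> \<bar>g x\<bar> \<le> B" using bdd[OF gH] by blast
    have [measurable]: "R ps \<in> borel_measurable \<mu>" "h \<in> borel_measurable \<mu>" "g \<in> borel_measurable \<mu>"
      using R_meas[OF ps] meas gH Cons.prems by auto
    have "(\<integral>x. h x * R ps x * indicator {a<..} (g x) \<partial>\<mu>) = (\<integral>x. h x * R ps x * indicator {a<..} (g x) \<partial>\<nu>)"
    proof (rule integral_indicator_eq_if_powers_eq[OF \<mu> \<nu>])
      show "\<bar>h x * R ps x\<bar> \<le> A" if "x \<in> space \<mu>" for x
        using A[OF that] R_ind[OF that] by (auto simp: indicator_def)
      show "(\<integral>x. h x * R ps x * g x ^ n \<partial>\<mu>) = (\<integral>x. h x * R ps x * g x ^ n \<partial>\<nu>)" for n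
        using Cons.IH[OF power[OF Cons.prems(1) gH] ps, of n] by (simp add: algebra_simps)
    qed (use B in auto)
    then show ?case by (simp add: R_def p algebra_simps)
  qed
  have P_sets: "P ps \<in> sets \<mu>" if "fst ` set ps \<subseteq> H" for ps
  proof -
    have "P ps = {x \<in> space \<mu>. R ps x = 1}"
      using R_ind by (auto simp: P_def indicator_def split: if_splits)
    then show ?thesis
      using R_meas[OF that] by simp
  qed
  define G where "G = {P ps | ps. fst ` set ps \<subseteq> H}"
  have P_eq: "measure \<mu> (P ps) = measure \<nu> (P ps)" if ps: "fst ` set ps \<subseteq> H" for ps
  proof -
    have "(\<integral>x. R ps x \<partial>\<mu>) = (\<integral>x. indicator (P ps) x \<partial>\<mu>)" "(\<integral>x. R ps x \<partial>\<nu>) = (\<integral>x. indicator (P ps) x \<partial>\<nu>)"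
      by (intro Bochner_Integration.integral_cong refl; simp add: R_ind sp)+
    moreover have "P ps \<inter> space \<mu> = P ps" by (auto simp: P_def)
    ultimately show ?thesis
      using key[OF one ps] by (simp add: sp)
  qed
  have Int: "Int_stable G"
  proof (rule Int_stableI)
    fix a b assume "a \<in> G" "b \<in> G"
    then obtain ps qs where "a = P ps" "b = P qs" "fst ` set ps \<subseteq> H" "fst ` set qs \<subseteq> H"
      by (auto simp: G_def)
    then have "a \<inter> b = P (ps @ qs)" "fst ` set (ps @ qs) \<subseteq> H"
      by (auto simp: P_def)
    then show "a \<inter> b \<in> G" unfolding G_def by blast
  qed
  have GP: "G \<subseteq> Pow (space \<mu>)" "G \<subseteq> sets \<mu>" using P_sets by (auto simp: G_def P_def)
  have "S \<in> sigma_sets (space \<mu>) G"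
  proof -
    have "{{x \<in> space \<mu>. a < h x} | h a. h \<in> H} \<subseteq> G"
    proof clarify
      fix h a assume "h \<in> H"
      then show "{x \<in> space \<mu>. a < h x} \<in> G"
        unfolding G_def by (intro CollectI exI[of _ "[(h, a)]"]) (auto simp: P_def)
    qed
    then show ?thesis using S sigma_sets_mono' by blast
  qed
  from Int GP(1) this show ?thesis
  proof (induction rule: sigma_sets_induct_disjoint)
    case (basic A)
    then show ?case using P_eq by (auto simp: G_def)
  next
    case (compl A)
    then have "A \<in> sets \<mu>" using sets.sigma_sets_subset[OF GP(2)] by blast
    then show ?case
      using compl.IH \<mu>.prob_compl[of A] \<nu>.prob_compl[of A] \<nu>(2) sp by simp
  next
    case (union A)
    then have A: "range A \<subseteq> sets \<mu>" using sets.sigma_sets_subset[OF GP(2)] by blast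
    have "(\<lambda>i. measure \<mu> (A i)) sums measure \<mu> (\<Union>i. A i)" "(\<lambda>i. measure \<nu> (A i)) sums measure \<nu> (\<Union>i. A i)"
      using A union.hyps \<nu>(2) by (auto intro!: \<mu>.finite_measure_UNION \<nu>.finite_measure_UNION)
    then show ?case using union.IH sums_unique2 by simp
  qed simp
qed

section \<open>Families of kernels on Polish spaces\<close>

locale kernel_family =
  fixes d :: nat and X :: "nat \<Rightarrow> 'a topology" and k :: "nat \<Rightarrow> 'a \<Rightarrow> 'a \<Rightarrow> real"
  assumes polish: "\<And>j. j < d \<Longrightarrow> Polish (X j)"
    and kernel: "\<And>j. j < d \<Longrightarrow> pd_kernel (topspace (X j)) (k j)"
    and bounded: "\<And>j. j < d \<Longrightarrow> bounded_kernel (topspace (X j)) (k j)"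
    and cont: "\<And>j. j < d \<Longrightarrow> continuous_map (prod_topology (X j) (X j)) euclideanreal (\<lambda>(x, y). k j x y)"
    and sep: "\<And>j. j < d \<Longrightarrow> point_separating (topspace (X j)) (k j)"
begin

section \<open>Monomials in the kernel sections\<close>

definition feature :: "nat \<times> 'a \<Rightarrow> (nat \<Rightarrow> 'a) \<Rightarrow> real" where
  "feature p x = k (fst p) (x (fst p)) (snd p)"

text \<open>Lists allow repeated coordinates and repeated factors, and concatenation multiplies: the
  monomials form a multiplicative class with the constant 1 as the empty product.\<close>

definition monomial :: "(nat \<times> 'a) list \<Rightarrow> (nat \<Rightarrow> 'a) \<Rightarrow> real" where
  "monomial ps x = (\<Prod>p\<leftarrow>ps. feature p x)"

definition points :: "(nat \<times> 'a) set" where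
  "points = (SIGMA l:{..<d}. topspace (X l))"

lemma kernel_measurable:
  assumes "j < d"
  shows "(\<lambda>(x, y). k j x y) \<in> borel_measurable (borel_of (X j) \<Otimes>\<^sub>M borel_of (X j))"
  using assms by (intro continuous_map_prod_measurable Polish_imp_second_countable polish cont)

lemma section_continuous:
  assumes "j < d" "z \<in> topspace (X j)"
  shows "continuous_map (X j) euclideanreal (\<lambda>x. k j x z)"
proof -
  have "continuous_map (X j) (prod_topology (X j) (X j)) (\<lambda>x. (x, z))"
    using assms(2) by (intro continuous_map_pairedI) auto
  from continuous_map_compose[OF this cont[OF assms(1)]] show ?thesis
    by (simp add: o_def)
qed

lemma kernel_bound:
  obtains B where "\<And>j x y. \<lbrakk>j < d; x \<in> topspace (X j); y \<in> topspace (X j)\<rbrakk> \<Longrightarrow> \<bar>k j x y\<bar> \<le> B" and "1 \<le> B"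
proof -
  have "\<forall>j. \<exists>B. j < d \<longrightarrow> (\<forall>x\<in>topspace (X j). \<forall>y\<in>topspace (X j). \<bar>k j x y\<bar> \<le> B)"
    using bounded unfolding bounded_kernel_def by blast
  then obtain B where B: "\<And>j x y. \<lbrakk>j < d; x \<in> topspace (X j); y \<in> topspace (X j)\<rbrakk> \<Longrightarrow> \<bar>k j x y\<bar> \<le> B j"
    by metis
  have le: "B j \<le> 1 + (\<Sum>i<d. \<bar>B i\<bar>)" if "j < d" for j
    using member_le_sum[of j "{..<d}" "\<lambda>i. \<bar>B i\<bar>"] that by force
  show thesis
  proof
    show "\<bar>k j x y\<bar> \<le> 1 + (\<Sum>i<d. \<bar>B i\<bar>)" if "j < d" "x \<in> topspace (X j)" "y \<in> topspace (X j)" for j x y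
      using B[OF that] le[OF that(1)] by linarith
    show "1 \<le> 1 + (\<Sum>i<d. \<bar>B i\<bar>)"
      by (simp add: sum_nonneg)
  qed
qed

lemma space_joint_space: "space (joint_space d X) = (\<Pi>\<^sub>E j\<in>{..<d}. topspace (X j))"
  by (simp add: joint_space_def space_PiM)

lemma feature_measurable:
  assumes "p \<in> points"
  shows "feature p \<in> borel_measurable (joint_space d X)"
proof -
  obtain l z where p: "p = (l, z)" "l < d" "z \<in> topspace (X l)"
    using assms by (auto simp: points_def)
  have "(\<lambda>x. x l) \<in> measurable (joint_space d X) (borel_of (X l))"
    unfolding joint_space_def using p by (intro measurable_component_singleton) auto
  from measurable_compose[OF this continuous_map_measurable[OF section_continuous[OF p(2,3)]]]
  show ?thesis by (simp add: feature_def[abs_def] p)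
qed

lemma feature_bound:
  obtains B where "\<And>p x. \<lbrakk>p \<in> points; x \<in> space (joint_space d X)\<rbrakk> \<Longrightarrow> \<bar>feature p x\<bar> \<le> B" and "1 \<le> B"
proof -
  obtain B where B: "\<And>j x y. \<lbrakk>j < d; x \<in> topspace (X j); y \<in> topspace (X j)\<rbrakk> \<Longrightarrow> \<bar>k j x y\<bar> \<le> B" "1 \<le> B"
    by (rule kernel_bound, rule that)
  show thesis
  proof (rule that[OF _ B(2)])
    fix p x assume p: "p \<in> points" and x: "x \<in> space (joint_space d X)"
    have l: "fst p < d" "snd p \<in> topspace (X (fst p))"
      using p by (auto simp: points_def)
    have "x (fst p) \<in> topspace (X (fst p))"
      using x l(1) unfolding space_joint_space by (auto dest: PiE_mem)
    then show "\<bar>feature p x\<bar> \<le> B"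
      unfolding feature_def using l by (intro B(1))
  qed
qed

lemma monomial_measurable:
  assumes "set ps \<subseteq> points"
  shows "monomial ps \<in> borel_measurable (joint_space d X)"
  using assms
proof (induction ps)
  case (Cons p ps)
  have "monomial (p # ps) = (\<lambda>x. feature p x * monomial ps x)"
    by (auto simp: monomial_def)
  then show ?case
    using Cons feature_measurable[of p] by auto
qed (simp add: monomial_def[abs_def])

lemma monomial_bounded:
  assumes "set ps \<subseteq> points"
  shows "\<exists>B. \<forall>x\<in>space (joint_space d X). \<bar>monomial ps x\<bar> \<le> B"
proof -
  obtain B where B: "\<And>p x. \<lbrakk>p \<in> points; x \<in> space (joint_space d X)\<rbrakk> \<Longrightarrow> \<bar>feature p x\<bar> \<le> B" "1 \<le> B"
    by (rule feature_bound, rule that)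
  have "\<bar>monomial ps x\<bar> \<le> B ^ length ps" if x: "x \<in> space (joint_space d X)" for x
    using assms
  proof (induction ps)
    case (Cons p ps)
    have "\<bar>feature p x\<bar> * \<bar>monomial ps x\<bar> \<le> B * B ^ length ps"
      using Cons B(1)[of p x] x B(2) by (intro mult_mono) auto
    then show ?case by (simp add: monomial_def abs_mult)
  qed (simp add: monomial_def)
  then show ?thesis by blast
qed

text \<open>Tightness replaces the Lusin--Souslin theorem: both measures live on a countable union of compact
  sets, and compact sets lie in the sigma-algebra generated by the separating functions.\<close>

theorem moments_determine_measure:
  assumes \<gamma>: "prob_space \<gamma>" "sets \<gamma> = sets (joint_space d X)"
    and \<eta>: "prob_space \<eta>" "sets \<eta> = sets (joint_space d X)"
    and moments: "\<And>ps. set ps \<subseteq> points \<Longrightarrow> (\<integral>x. monomial ps x \<partial>\<gamma>) = (\<integral>x. monomial ps x \<partial>\<eta>)"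
  shows "\<gamma> = \<eta>"
proof -
  let ?J = "joint_space d X"
  interpret \<gamma>: prob_space \<gamma> by fact
  interpret \<eta>: prob_space \<eta> by fact
  have sp: "space \<gamma> = space ?J" "space \<eta> = space ?J"
    using \<gamma>(2) \<eta>(2) by (auto dest: sets_eq_imp_space_eq)
  define H where "H = {monomial ps | ps. set ps \<subseteq> points}"
  define G where "G = {{x \<in> space ?J. a < h x} | h a. h \<in> H}"
  have GP: "G \<subseteq> Pow (space ?J)" by (auto simp: G_def)
  define N where "N = sigma (space ?J) G"
  have N: "space N = space ?J" "sets N = sigma_sets (space ?J) G"
    unfolding N_def using GP by auto
  have agree: "measure \<gamma> S = measure \<eta> S" if "S \<in> sets N" for S
  proof (rule multiplicative_class_determines_measure[where H=H, OF \<gamma>(1) \<eta>(1)])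
    show "sets \<eta> = sets \<gamma>" using \<gamma>(2) \<eta>(2) by simp
    show "h \<in> borel_measurable \<gamma>" if "h \<in> H" for h
      using that monomial_measurable \<gamma>(2) by (auto simp: H_def cong: measurable_cong_sets)
    show "\<exists>B. \<forall>x\<in>space \<gamma>. \<bar>h x\<bar> \<le> B" if "h \<in> H" for h
      using that monomial_bounded by (auto simp: H_def sp)
    have "(\<lambda>_. 1) = monomial []" by (auto simp: monomial_def)
    then show "(\<lambda>_. 1) \<in> H" unfolding H_def by (intro CollectI exI[of _ "[]"]) auto
    show "(\<lambda>x. h x * g x) \<in> H" if hg: "h \<in> H" "g \<in> H" for h g
    proof -
      obtain ps qs where "h = monomial ps" "g = monomial qs" "set ps \<subseteq> points" "set qs \<subseteq> points"
        using hg by (auto simp: H_def)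
      then have "(\<lambda>x. h x * g x) = monomial (ps @ qs)" "set (ps @ qs) \<subseteq> points"
        by (auto simp: monomial_def)
      then show ?thesis unfolding H_def by blast
    qed
    show "(\<integral>x. h x \<partial>\<gamma>) = (\<integral>x. h x \<partial>\<eta>)" if "h \<in> H" for h
      using that moments by (auto simp: H_def)
    show "S \<in> sigma_sets (space \<gamma>) {{x \<in> space \<gamma>. a < h x} | h a. h \<in> H}"
      using that by (simp add: N sp G_def)
  qed
  \<comment> \<open>\<open>E\<close> is to carry the full mass of the \<open>l\<close>-th coordinate
    under both measures, and to be so small that Borel sets cut down to it pull back to sets of
    \<open>N\<close>.\<close>
  define Q where "Q l E \<longleftrightarrow> (AE x in \<gamma>. x l \<in> E) \<and> (AE x in \<eta>. x l \<in> E) \<and>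
      (\<forall>A\<in>sets (borel_of (X l)). {x \<in> space ?J. x l \<in> A \<inter> E} \<in> sets N)" for l E
  have "\<exists>E. Q l E" if l: "l < d" for l
  proof -
    let ?X = "X l"
    define F where "F = {\<lambda>x. k l x z | z. z \<in> topspace ?X}"
    \<comment> \<open>The sigma-algebra of the sections on the single factor: it contains the
      compact sets, and the coordinate map pulls it back into \<open>N\<close>.\<close>
    define N' where "N' = sigma (topspace ?X) {{x \<in> topspace ?X. a < f x} | f a. f \<in> F}"
    have N'_sets: "sets N' = sigma_sets (topspace ?X) {{x \<in> topspace ?X. a < f x} | f a. f \<in> F}"
      and N'_space: "space N' = topspace ?X"
      unfolding N'_def by (auto intro!: sets_measure_of space_measure_of)
    have coord: "(\<lambda>x. x l) \<in> measurable N N'"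
      unfolding N'_def
    proof (rule measurable_measure_of)
      show "(\<lambda>x. x l) \<in> space N \<rightarrow> topspace ?X"
        using l by (auto simp: N space_joint_space)
      fix B assume "B \<in> {{x \<in> topspace ?X. a < f x} | f a. f \<in> F}"
      then obtain z a where z: "z \<in> topspace ?X" "B = {x \<in> topspace ?X. a < k l x z}"
        by (auto simp: F_def)
      have "(\<lambda>x. x l) -` B \<inter> space N = {x \<in> space ?J. a < monomial [(l, z)] x}"
        using l by (auto simp: z N space_joint_space monomial_def feature_def)
      also have "monomial [(l, z)] \<in> H"
        using l z unfolding H_def points_def by (intro CollectI exI[of _ "[(l, z)]"]) auto
      then have "{x \<in> space ?J. a < monomial [(l, z)] x} \<in> sets N"
        unfolding N G_def by blast
      finally show "(\<lambda>x. x l) -` B \<inter> space N \<in> sets N" .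
    qed auto
    have F_cont: "continuous_map ?X euclideanreal f" if "f \<in> F" for f
      using that section_continuous[OF l] by (auto simp: F_def)
    have F_sep: "\<exists>f\<in>F. f x \<noteq> f y" if "x \<in> topspace ?X" "y \<in> topspace ?X" "x \<noteq> y" for x y
    proof -
      have "(\<lambda>z\<in>topspace ?X. k l x z) \<noteq> (\<lambda>z\<in>topspace ?X. k l y z)"
        using sep[OF l] that unfolding point_separating_def inj_on_def by blast
      then obtain z where "z \<in> topspace ?X" "k l x z \<noteq> k l y z"
        by (metis restrict_ext)
      then show ?thesis by (auto simp: F_def)
    qed
    have F_meas: "f \<in> borel_measurable N'" if "f \<in> F" for f
      unfolding borel_measurable_iff_greater N'_sets N'_space using that by blast
    note compact_sets = compactin_generated_by_separating[OF Polish_imp_second_countable[OF polish[OF l]]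
        F_cont F_sep _ N'_space F_meas]
    have marg: "\<exists>C::nat \<Rightarrow> 'a set. (\<forall>n. compactin ?X (C n)) \<and> (AE x in \<mu>. x l \<in> (\<Union>n. C n))"
      if \<mu>: "prob_space \<mu>" "sets \<mu> = sets ?J" for \<mu>
    proof -
      have m: "(\<lambda>x. x l) \<in> measurable \<mu> (borel_of ?X)"
        using l \<mu>(2) measurable_component_singleton[of l "{..<d}" "\<lambda>j. borel_of (X j)"]
        by (auto simp: joint_space_def cong: measurable_cong_sets)
      obtain C :: "nat \<Rightarrow> 'a set" where C: "\<And>n. compactin ?X (C n)"
        and AE: "AE x in distr \<mu> (borel_of ?X) (\<lambda>x. x l). x \<in> (\<Union>n. C n)"
        by (rule Polish_sigma_compact_support[OF polish[OF l] prob_space.prob_space_distr[OF \<mu>(1) m] sets_distr], rule that)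
      from AE_distrD[OF m AE] C show ?thesis by blast
    qed
    obtain C1 :: "nat \<Rightarrow> 'a set" where C1: "\<And>n. compactin ?X (C1 n)" "AE x in \<gamma>. x l \<in> (\<Union>n. C1 n)"
      using marg[OF \<gamma>] by blast
    obtain C2 :: "nat \<Rightarrow> 'a set" where C2: "\<And>n. compactin ?X (C2 n)" "AE x in \<eta>. x l \<in> (\<Union>n. C2 n)"
      using marg[OF \<eta>] by blast
    define E where "E = (\<Union>n. C1 n) \<union> (\<Union>n. C2 n)"
    have E_top: "E \<subseteq> topspace ?X"
      unfolding E_def by (intro Un_least UN_least compactin_subset_topspace C1 C2)
    have E_sets: "E \<in> sets N'"
      unfolding E_def using compact_sets C1(1) C2(1) by auto
    \<comment> \<open>The complement of an open set meets each compact piece of \<open>E\<close> in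
      a compact set, which lies in \<open>N'\<close>; removing these pieces from \<open>E\<close>
      leaves the trace of the open set.\<close>
    have trace: "A \<inter> E \<in> sets N'" if "A \<in> sets (borel_of ?X)" for A
      using that unfolding sets_borel_of
    proof (induction rule: sigma_sets.induct)
      case (Basic U)
      then have U: "openin ?X U" by simp
      let ?F = "topspace ?X - U"
      have "closedin ?X ?F" using U by blast
      then have "?F \<inter> C1 n \<in> sets N'" "?F \<inter> C2 n \<in> sets N'" for n
        by (auto intro!: compact_sets closed_Int_compactin C1 C2)
      then have "E - ((\<Union>n. ?F \<inter> C1 n) \<union> (\<Union>n. ?F \<inter> C2 n)) \<in> sets N'"
        using E_sets by (intro sets.Diff sets.Un sets.countable_UN) auto
      moreover have "U \<inter> E = E - ((\<Union>n. ?F \<inter> C1 n) \<union> (\<Union>n. ?F \<inter> C2 n))"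
        using E_top by (auto simp: E_def)
      ultimately show ?case by simp
    next
      case (Compl A)
      have "E - A \<inter> E \<in> sets N'" using E_sets Compl by auto
      moreover have "(topspace ?X - A) \<inter> E = E - A \<inter> E" using E_top by blast
      ultimately show ?case by simp
    next
      case (Union A)
      have "(\<Union>i. A i) \<inter> E = (\<Union>i. A i \<inter> E)" by blast
      moreover have "(\<Union>i. A i \<inter> E) \<in> sets N'"
        using Union.IH by (intro sets.countable_UN) auto
      ultimately show ?case by (rule ssubst)
    qed simp
    have "{x \<in> space ?J. x l \<in> A \<inter> E} \<in> sets N" if "A \<in> sets (borel_of ?X)" for A
    proof -
      have "{x \<in> space ?J. x l \<in> A \<inter> E} = (\<lambda>x. x l) -` (A \<inter> E) \<inter> space N"
        by (auto simp: N)
      then show ?thesis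
        using measurable_sets[OF coord trace[OF that]] by simp
    qed
    moreover have "AE x in \<gamma>. x l \<in> E" "AE x in \<eta>. x l \<in> E"
      using C1(2) C2(2) by (auto simp: E_def)
    ultimately have "Q l E" unfolding Q_def by blast
    then show ?thesis by blast
  qed
  then obtain E where "\<And>l. l < d \<Longrightarrow> Q l (E l)"
    by metis
  then have E: "\<And>l. l < d \<Longrightarrow> AE x in \<gamma>. x l \<in> E l" "\<And>l. l < d \<Longrightarrow> AE x in \<eta>. x l \<in> E l"
    and E_N: "\<And>l A. \<lbrakk>l < d; A \<in> sets (borel_of (X l))\<rbrakk> \<Longrightarrow> {x \<in> space ?J. x l \<in> A \<inter> E l} \<in> sets N"
    unfolding Q_def by blast+
  define D where "D = {x \<in> space ?J. \<forall>l\<in>{..<d}. x l \<in> E l}"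
  have D_N: "D \<in> sets N"
  proof -
    have "{x \<in> space ?J. x l \<in> E l} \<in> sets N" if "l < d" for l
    proof -
      have "{x \<in> space ?J. x l \<in> topspace (X l) \<inter> E l} = {x \<in> space ?J. x l \<in> E l}"
        using that by (auto simp: space_joint_space)
      then show ?thesis
        using E_N[OF that sets.top] by simp
    qed
    then show ?thesis
      unfolding D_def N(1)[symmetric] by (intro sets.sets_Collect_finite_All) auto
  qed
  have trace: "S \<inter> D \<in> sets N" if "S \<in> sets ?J" for S
    using that unfolding joint_space_def sets_PiM_single
  proof (induction rule: sigma_sets.induct)
    case (Basic S)
    then obtain l A where S: "S = {x \<in> space ?J. x l \<in> A}" "l < d" "A \<in> sets (borel_of (X l))"
      by (auto simp: space_joint_space)
    have "S \<inter> D = {x \<in> space ?J. x l \<in> A \<inter> E l} \<inter> D"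
      by (auto simp: S(1) D_def \<open>l < d\<close>)
    then show ?case using E_N[OF S(2,3)] D_N by simp
  next
    case (Compl S)
    have "(space ?J - S) \<inter> D = D - S \<inter> D" by (auto simp: D_def)
    then show ?case using Compl D_N by (simp add: space_joint_space)
  next
    case (Union S)
    have "(\<Union>i. S i) \<inter> D = (\<Union>i. S i \<inter> D)" by blast
    moreover have "(\<Union>i. S i \<inter> D) \<in> sets N"
      using Union.IH by (intro sets.countable_UN) auto
    ultimately show ?case by (rule ssubst)
  qed simp
  have NJ: "sets N \<subseteq> sets ?J"
  proof -
    have "G \<subseteq> sets ?J"
      unfolding G_def H_def using monomial_measurable borel_measurable_iff_greater by blast
    then show ?thesis unfolding N by (rule sets.sigma_sets_subset)
  qed
  have AE_D: "AE x in \<gamma>. x \<in> D" "AE x in \<eta>. x \<in> D"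
    using E AE_space[of \<gamma>] AE_space[of \<eta>] by (auto simp: D_def sp AE_ball_countable)
  show "\<gamma> = \<eta>"
  proof (rule measure_eqI)
    \<comment> \<open>Both measures live on \<open>D\<close>, and the trace of \<open>S\<close> on
      \<open>D\<close> is in \<open>N\<close>, where agreement is known.\<close>
    fix S assume S: "S \<in> sets \<gamma>"
    then have SJ: "S \<in> sets ?J" "S \<inter> D \<in> sets ?J" using \<gamma>(2) trace NJ by auto
    have "measure \<gamma> S = measure \<gamma> (S \<inter> D)"
      using SJ \<gamma>(2) AE_D(1) by (intro measure_eq_AE) auto
    also have "\<dots> = measure \<eta> (S \<inter> D)"
      by (rule agree[OF trace[OF SJ(1)]])
    also have "\<dots> = measure \<eta> S"
      using SJ \<eta>(2) AE_D(2) by (intro measure_eq_AE) auto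
    finally show "emeasure \<gamma> S = emeasure \<eta> S"
      by (simp add: \<gamma>.emeasure_eq_measure \<eta>.emeasure_eq_measure)
  qed (use \<gamma>(2) \<eta>(2) in simp)
qed

end

section \<open>Multi-indices\<close>

lemma aidx_less:
  assumes "j < deg d i"
  shows "aidx i j < d"
proof -
  have "d \<noteq> 0" using assms by (intro notI) (simp add: deg_def)
  then have "j < (\<Sum>l'<Suc (d - 1). i l')"
    using assms by (simp add: deg_def)
  then have "aidx i j \<le> d - 1"
    unfolding aidx_def by (rule Least_le)
  with \<open>d \<noteq> 0\<close> show ?thesis by linarith
qed

lemma sum_count_list_lessThan: "(\<Sum>l<n. count_list xs l) = length (filter (\<lambda>x. x < n) xs)" for n :: nat
proof (induction xs)
  case (Cons x xs)
  have "(\<Sum>l<n. count_list (x # xs) l) = (\<Sum>l<n. count_list xs l + (if l = x then 1 else 0))"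
    by (rule sum.cong) auto
  then show ?case using Cons by (simp add: sum.distrib)
qed simp

lemma less_length_filter_sorted_iff:
  fixes xs :: "nat list"
  assumes "sorted xs" "j < length xs"
  shows "j < length (filter (\<lambda>x. x < n) xs) \<longleftrightarrow> xs ! j < n"
  using assms
proof (induction xs arbitrary: j)
  case (Cons x xs)
  show ?case
  proof (cases "x < n")
    case True
    then show ?thesis using Cons by (cases j) auto
  next
    case False
    then have "\<not> y < n" if "y \<in> set (x # xs)" for y
      using Cons.prems(1) that by fastforce
    then have "filter (\<lambda>x. x < n) (x # xs) = []" "\<not> (x # xs) ! j < n"
      using nth_mem[OF Cons.prems(2)] by (auto simp: filter_empty_conv)
    then show ?thesis by simp
  qed
qed simp

text \<open>In a sorted list the entries below \<open>n\<close> fill an initial segment, so the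
  least \<open>l\<close> for which position \<open>j\<close> lies among the entries below
  \<open>Suc l\<close> is the entry at \<open>j\<close>. Thus every sorted list of coordinates is
  the index sequence of its multiplicities.\<close>

lemma aidx_count_list:
  assumes "sorted xs" "j < length xs"
  shows "aidx (count_list xs) j = xs ! j"
  unfolding aidx_def sum_count_list_lessThan less_length_filter_sorted_iff[OF assms]
  by (rule Least_equality) auto

lemma finite_partitions: "finite (partitions m)"
  unfolding partitions_def by (rule finitely_many_partition_on) simp

text \<open>A block equal to \<open>A\<close> leaves, by disjointness, no room for another nonempty
  block. This keeps the moments at the blocks below full degree.\<close>

lemma partition_on_block_psubset:
  assumes "partition_on A \<pi>" "\<pi> \<noteq> {A}" "B \<in> \<pi>"
  shows "B \<subset> A"
proof -
  have "B \<subseteq> A" using partition_onD1[OF assms(1)] assms(3) by blast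
  moreover have "B \<noteq> A"
  proof
    assume "B = A"
    have "C = A" if "C \<in> \<pi>" for C
    proof (rule ccontr)
      assume "C \<noteq> A"
      then have "C \<inter> A = {}"
        using disjointD[OF partition_onD2[OF assms(1)] that assms(3)] \<open>B = A\<close> by simp
      moreover have "C \<subseteq> A" "C \<noteq> {}"
        using partition_onD1[OF assms(1)] partition_onD3[OF assms(1)] that by auto
      ultimately show False by blast
    qed
    then show False using assms(2,3) \<open>B = A\<close> by blast
  qed
  ultimately show ?thesis by blast
qed

section \<open>Kernelized cumulants\<close>

context kernel_family
begin

lemma space_tens_space: "space (tens_space d X i) = tens_carrier d X i"
  by (simp add: tens_space_def tens_carrier_def space_PiM)

lemma bounded_measurable_ktens:
  obtains B where "bounded_measurable_kernel (tens_space d X i) (ktens d k i) B"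
proof -
  let ?T = "tens_space d X i"
  obtain B where B: "\<And>j x y. \<lbrakk>j < d; x \<in> topspace (X j); y \<in> topspace (X j)\<rbrakk> \<Longrightarrow> \<bar>k j x y\<bar> \<le> B" "1 \<le> B"
    by (rule kernel_bound, rule that)
  have coord: "z j \<in> topspace (X (aidx i j))" if "z \<in> space ?T" "j < deg d i" for z j
    using that by (auto simp: space_tens_space tens_carrier_def dest: PiE_mem)
  have "bounded_measurable_kernel ?T (ktens d k i) (B ^ deg d i)"
  proof
    show "pd_kernel (space ?T) (ktens d k i)"
      unfolding ktens_def[abs_def]
    proof (rule pd_kernel_prod)
      fix j assume "j \<in> {..<deg d i}"
      then show "pd_kernel (space ?T) (\<lambda>z z'. k (aidx i j) (z j) (z' j))"
        by (intro pd_kernel_comp[OF kernel]) (auto intro: aidx_less coord)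
    qed simp
    show "(\<lambda>(x, y). ktens d k i x y) \<in> borel_measurable (?T \<Otimes>\<^sub>M ?T)"
      unfolding ktens_def case_prod_beta
    proof (rule borel_measurable_prod)
      fix j assume j: "j \<in> {..<deg d i}"
      have [measurable]: "(\<lambda>z. z j) \<in> measurable ?T (borel_of (X (aidx i j)))"
        unfolding tens_space_def by (rule measurable_component_singleton[OF j])
      have "(\<lambda>p. (fst p j, snd p j)) \<in> measurable (?T \<Otimes>\<^sub>M ?T) (borel_of (X (aidx i j)) \<Otimes>\<^sub>M borel_of (X (aidx i j)))"
        by measurable
      from measurable_compose[OF this kernel_measurable[OF aidx_less]] j
      show "(\<lambda>p. k (aidx i j) (fst p j) (snd p j)) \<in> borel_measurable (?T \<Otimes>\<^sub>M ?T)"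
        by simp
    qed
    show "\<bar>ktens d k i x y\<bar> \<le> B ^ deg d i" if "x \<in> space ?T" "y \<in> space ?T" for x y
    proof -
      have "(\<Prod>j<deg d i. \<bar>k (aidx i j) (x j) (y j)\<bar>) \<le> (\<Prod>j<deg d i. B)"
        using that by (intro prod_mono conjI abs_ge_zero B(1) aidx_less coord) auto
      then show ?thesis by (simp add: ktens_def abs_prod)
    qed
  qed
  then show thesis by (rule that)
qed

section \<open>Partition measures and joint moments\<close>

context
  fixes \<gamma> :: "(nat \<Rightarrow> 'a) measure"
  assumes \<gamma>: "prob_space \<gamma>" "sets \<gamma> = sets (joint_space d X)"
begin

lemma measurable_diag:
  assumes "B \<subseteq> {..<deg d i}"
  shows "(\<lambda>x. \<lambda>j\<in>B. x (aidx i j)) \<in> measurable \<gamma> (PiM B (\<lambda>j. borel_of (X (aidx i j))))"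
proof (rule measurable_restrict)
  fix j assume "j \<in> B"
  then have "aidx i j \<in> {..<d}" using assms aidx_less by auto
  from measurable_component_singleton[OF this, of "\<lambda>j. borel_of (X j)"]
  show "(\<lambda>x. x (aidx i j)) \<in> measurable \<gamma> (borel_of (X (aidx i j)))"
    using \<gamma>(2) by (simp add: joint_space_def cong: measurable_cong_sets)
qed

lemma block_marginal_eq_distr:
  assumes "B \<subseteq> {..<deg d i}"
  shows "block_marginal d X i \<gamma> B
    = distr \<gamma> (PiM B (\<lambda>j. borel_of (X (aidx i j)))) (\<lambda>x. \<lambda>j\<in>B. x (aidx i j))"
proof -
  have "(\<lambda>z. restrict z B) \<in> measurable (tens_space d X i) (PiM B (\<lambda>j. borel_of (X (aidx i j))))"
    unfolding tens_space_def by (rule measurable_restrict_subset[OF assms])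
  moreover have "restrict (\<lambda>j\<in>{..<deg d i}. x (aidx i j)) B = (\<lambda>j\<in>B. x (aidx i j))" for x :: "nat \<Rightarrow> 'a"
    using assms by (auto simp: restrict_def fun_eq_iff)
  ultimately show ?thesis
    unfolding block_marginal_def diag_measure_def
    using measurable_diag[OF order_refl, of i] by (subst distr_distr) (auto simp: tens_space_def o_def)
qed

lemma prob_space_block_marginal:
  "B \<subseteq> {..<deg d i} \<Longrightarrow> prob_space (block_marginal d X i \<gamma> B)"
  unfolding block_marginal_eq_distr by (intro prob_space.prob_space_distr[OF \<gamma>(1)] measurable_diag)

text \<open>\<open>product_prob_space\<close> asks for a probability measure at every index, not
  only at the blocks; the point mass is a filler outside \<pi>.\<close>

definition block_family :: "(nat \<Rightarrow> nat) \<Rightarrow> nat set set \<Rightarrow> nat set \<Rightarrow> (nat \<Rightarrow> 'a) measure" where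
  "block_family i \<pi> B = (if B \<in> \<pi> then block_marginal d X i \<gamma> B else return (count_space UNIV) undefined)"

lemma product_prob_space_block_family:
  assumes "partition_on {..<deg d i} \<pi>"
  shows "product_prob_space (block_family i \<pi>)"
proof (rule product_prob_spaceI)
  fix B
  have "B \<subseteq> {..<deg d i}" if "B \<in> \<pi>"
    using assms that partition_onD1 by blast
  then show "prob_space (block_family i \<pi> B)"
    by (auto simp: block_family_def intro: prob_space_block_marginal prob_space_return)
qed

lemma PiM_block_family: "PiM \<pi> (block_marginal d X i \<gamma>) = PiM \<pi> (block_family i \<pi>)"
  by (rule PiM_cong) (auto simp: block_family_def)

lemma the_block:
  assumes "partition_on A \<pi>" "B \<in> \<pi>" "j \<in> B"
  shows "(THE B. B \<in> \<pi> \<and> j \<in> B) = B"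
proof (rule the_equality)
  fix C assume "C \<in> \<pi> \<and> j \<in> C"
  then show "C = B"
    using disjointD[OF partition_onD2[OF assms(1)], of C B] assms by blast
qed (use assms in simp)

lemma measurable_glue:
  assumes \<pi>: "partition_on {..<deg d i} \<pi>"
  shows "(\<lambda>w. \<lambda>j\<in>{..<deg d i}. w (THE B. B \<in> \<pi> \<and> j \<in> B) j)
    \<in> measurable (PiM \<pi> (block_family i \<pi>)) (tens_space d X i)"
  unfolding tens_space_def
proof (rule measurable_restrict)
  fix j assume "j \<in> {..<deg d i}"
  then obtain B where B: "B \<in> \<pi>" "j \<in> B" using partition_onD1[OF \<pi>] by blast
  have "sets (block_family i \<pi> B) = sets (PiM B (\<lambda>j. borel_of (X (aidx i j))))"
    using B by (simp add: block_family_def block_marginal_def)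
  then have "(\<lambda>u. u j) \<in> measurable (block_family i \<pi> B) (borel_of (X (aidx i j)))"
    using measurable_component_singleton[OF B(2), of "\<lambda>j. borel_of (X (aidx i j))"]
    by (simp cong: measurable_cong_sets)
  from measurable_compose[OF measurable_component_singleton[OF B(1), of "block_family i \<pi>"] this]
  show "(\<lambda>w. w (THE B. B \<in> \<pi> \<and> j \<in> B) j) \<in> measurable (PiM \<pi> (block_family i \<pi>)) (borel_of (X (aidx i j)))"
    by (simp add: the_block[OF \<pi> B])
qed

lemma partition_measure_in_prob_measures:
  assumes \<pi>: "\<pi> \<in> partitions (deg d i)"
  shows "partition_measure d X i \<gamma> \<pi> \<in> prob_measures (tens_space d X i)"
proof -
  have \<pi>': "partition_on {..<deg d i} \<pi>" using \<pi> by (simp add: partitions_def)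
  interpret product_prob_space "block_family i \<pi>"
    by (rule product_prob_space_block_family[OF \<pi>'])
  have "prob_space (PiM \<pi> (block_family i \<pi>))" by (rule prob_space_PiM) (rule prob_space)
  then show ?thesis
    unfolding prob_measures_def partition_measure_def PiM_block_family
    by (auto intro!: prob_space.prob_space_distr measurable_glue[OF \<pi>'])
qed

text \<open>Under the diagonal measure, position \<open>j\<close> repeats coordinate
  \<open>aidx i j\<close>, so a block integral is a joint moment of the original measure;
  \<open>sorted_list_of_set\<close> only picks an order of the factors.\<close>

lemma integral_block_marginal:
  assumes B: "B \<subseteq> {..<deg d i}" and z: "z \<in> tens_carrier d X i"
  shows "integrable (block_marginal d X i \<gamma> B) (\<lambda>u. \<Prod>j\<in>B. k (aidx i j) (u j) (z j))"
    and "(\<integral>u. (\<Prod>j\<in>B. k (aidx i j) (u j) (z j)) \<partial>block_marginal d X i \<gamma> B)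
      = (\<integral>x. monomial (map (\<lambda>j. (aidx i j, z j)) (sorted_list_of_set B)) x \<partial>\<gamma>)"
proof -
  let ?P = "PiM B (\<lambda>j. borel_of (X (aidx i j)))" and ?ps = "map (\<lambda>j. (aidx i j, z j)) (sorted_list_of_set B)"
  interpret prob_space \<gamma> by (rule \<gamma>(1))
  have fin: "finite B" using B by (rule finite_subset) simp
  have zB: "z j \<in> topspace (X (aidx i j))" "aidx i j < d" if "j \<in> B" for j
    using z B that aidx_less by (auto simp: tens_carrier_def dest: PiE_mem)
  have meas: "(\<lambda>u. \<Prod>j\<in>B. k (aidx i j) (u j) (z j)) \<in> borel_measurable ?P"
  proof (rule borel_measurable_prod)
    fix j assume j: "j \<in> B"
    show "(\<lambda>u. k (aidx i j) (u j) (z j)) \<in> borel_measurable ?P"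
      by (rule measurable_compose[OF measurable_component_singleton[OF j, of "\<lambda>j. borel_of (X (aidx i j))"]
            continuous_map_measurable[OF section_continuous[OF zB(2,1)[OF j]]]])
  qed
  have eq: "(\<Prod>j\<in>B. k (aidx i j) ((\<lambda>j\<in>B. x (aidx i j)) j) (z j)) = monomial ?ps x" for x
    using fin by (simp add: monomial_def feature_def o_def prod.distinct_set_conv_list[symmetric])
  have ps: "set ?ps \<subseteq> points"
    using zB fin by (auto simp: points_def)
  obtain C where C: "\<forall>x\<in>space (joint_space d X). \<bar>monomial ?ps x\<bar> \<le> C"
    using monomial_bounded[OF ps] by blast
  have int: "integrable \<gamma> (monomial ?ps)"
    by (rule integrable_const_bound[where B=C])
       (use C monomial_measurable[OF ps] \<gamma>(2) sets_eq_imp_space_eq[OF \<gamma>(2)] in \<open>auto cong: measurable_cong_sets\<close>)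
  show "integrable (block_marginal d X i \<gamma> B) (\<lambda>u. \<Prod>j\<in>B. k (aidx i j) (u j) (z j))"
    unfolding block_marginal_eq_distr[OF B]
    using int by (subst integrable_distr_eq[OF measurable_diag[OF B] meas]) (simp only: eq)
  show "(\<integral>u. (\<Prod>j\<in>B. k (aidx i j) (u j) (z j)) \<partial>block_marginal d X i \<gamma> B) = (\<integral>x. monomial ?ps x \<partial>\<gamma>)"
    unfolding block_marginal_eq_distr[OF B]
    by (subst integral_distr[OF measurable_diag[OF B] meas]) (simp only: eq)
qed

text \<open>Independence of the blocks: the tensor kernel factorises along the partition, and the
  product measure integrates each factor separately into a moment.\<close>

lemma integral_partition_measure:
  assumes \<pi>: "\<pi> \<in> partitions (deg d i)" and z: "z \<in> tens_carrier d X i"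
  shows "(\<integral>Z. ktens d k i Z z \<partial>partition_measure d X i \<gamma> \<pi>)
    = (\<Prod>B\<in>\<pi>. \<integral>x. monomial (map (\<lambda>j. (aidx i j, z j)) (sorted_list_of_set B)) x \<partial>\<gamma>)"
proof -
  have \<pi>': "partition_on {..<deg d i} \<pi>" using \<pi> by (simp add: partitions_def)
  have fin: "finite \<pi>" by (rule finite_elements[OF _ \<pi>']) simp
  have sub: "B \<subseteq> {..<deg d i}" if "B \<in> \<pi>" for B
    using partition_onD1[OF \<pi>'] that by blast
  interpret product_prob_space "block_family i \<pi>"
    by (rule product_prob_space_block_family[OF \<pi>'])
  let ?g = "\<lambda>w. \<lambda>j\<in>{..<deg d i}. w (THE B. B \<in> \<pi> \<and> j \<in> B) j"
  obtain C where K: "bounded_measurable_kernel (tens_space d X i) (ktens d k i) C"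
    by (rule bounded_measurable_ktens, rule that)
  have meas: "(\<lambda>Z. ktens d k i Z z) \<in> borel_measurable (tens_space d X i)"
    using bounded_measurable_kernel.meas_section(2)[OF K] z by (simp add: space_tens_space)
  have split: "ktens d k i (?g w) z = (\<Prod>B\<in>\<pi>. \<Prod>j\<in>B. k (aidx i j) (w B j) (z j))" for w
  proof -
    have "ktens d k i (?g w) z = (\<Prod>j\<in>\<Union>\<pi>. k (aidx i j) (w (THE B. B \<in> \<pi> \<and> j \<in> B) j) (z j))"
      unfolding ktens_def partition_onD1[OF \<pi>', symmetric] by (rule prod.cong) auto
    also have "\<dots> = (\<Prod>B\<in>\<pi>. \<Prod>j\<in>B. k (aidx i j) (w (THE B. B \<in> \<pi> \<and> j \<in> B) j) (z j))"
      using disjointD[OF partition_onD2[OF \<pi>']] finite_subset[OF sub]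
      by (subst prod.Union_disjoint) auto
    also have "\<dots> = (\<Prod>B\<in>\<pi>. \<Prod>j\<in>B. k (aidx i j) (w B j) (z j))"
      by (intro prod.cong refl) (simp add: the_block[OF \<pi>'])
    finally show ?thesis .
  qed
  have fam: "block_family i \<pi> B = block_marginal d X i \<gamma> B" if "B \<in> \<pi>" for B
    using that by (simp add: block_family_def)
  have "(\<integral>Z. ktens d k i Z z \<partial>partition_measure d X i \<gamma> \<pi>)
      = (\<integral>w. ktens d k i (?g w) z \<partial>PiM \<pi> (block_family i \<pi>))"
    unfolding partition_measure_def PiM_block_family
    by (rule integral_distr[OF measurable_glue[OF \<pi>'] meas])
  also have "\<dots> = (\<integral>w. (\<Prod>B\<in>\<pi>. (\<lambda>u. \<Prod>j\<in>B. k (aidx i j) (u j) (z j)) (w B)) \<partial>PiM \<pi> (block_family i \<pi>))"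
    unfolding split ..
  also have "\<dots> = (\<Prod>B\<in>\<pi>. \<integral>u. (\<Prod>j\<in>B. k (aidx i j) (u j) (z j)) \<partial>block_family i \<pi> B)"
    by (rule product_integral_prod[OF fin]) (simp add: fam integral_block_marginal(1)[OF sub z])
  also have "\<dots> = (\<Prod>B\<in>\<pi>. \<integral>x. monomial (map (\<lambda>j. (aidx i j, z j)) (sorted_list_of_set B)) x \<partial>\<gamma>)"
    by (intro prod.cong refl) (simp add: fam integral_block_marginal(2)[OF sub z])
  finally show ?thesis .
qed

lemma kcumulant_eq:
  assumes "z \<in> tens_carrier d X i"
  shows "kcumulant d X k i \<gamma> z = (\<Sum>\<pi>\<in>partitions (deg d i). cpi \<pi> *
    (\<Prod>B\<in>\<pi>. \<integral>x. monomial (map (\<lambda>j. (aidx i j, z j)) (sorted_list_of_set B)) x \<partial>\<gamma>))"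
  unfolding kcumulant_def by (intro sum.cong refl arg_cong2[where f="(*)"] integral_partition_measure assms)

end

text \<open>\<open>aidx i\<close> enumerates the coordinates in nondecreasing order, so a list has
  to be sorted before it can be matched with a multi-index; the product is unaffected.\<close>

lemma monomial_sort: "monomial (sort_key f ps) = monomial ps"
proof
  fix x
  have "prod_mset (image_mset (\<lambda>p. feature p x) (mset (sort_key f ps)))
      = prod_mset (image_mset (\<lambda>p. feature p x) (mset ps))" by simp
  then show "monomial (sort_key f ps) x = monomial ps x"
    unfolding monomial_def by (simp only: mset_map[symmetric] prod_mset_prod_list)
qed

text \<open>In a cumulant of degree \<open>m\<close>, the full moment occurs only through the one-block partition, where
  its coefficient is \<open>1\<close>; all other terms are products of moments of lower degree.\<close>

lemma moments_eq_if_cumulants_eq: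
  assumes \<gamma>: "prob_space \<gamma>" "sets \<gamma> = sets (joint_space d X)"
    and \<eta>: "prob_space \<eta>" "sets \<eta> = sets (joint_space d X)"
    and cum: "\<And>i z. \<lbrakk>\<forall>l\<ge>d. i l = 0; 1 \<le> deg d i; z \<in> tens_carrier d X i\<rbrakk>
      \<Longrightarrow> kcumulant d X k i \<gamma> z = kcumulant d X k i \<eta> z"
    and "set ps \<subseteq> points"
  shows "(\<integral>x. monomial ps x \<partial>\<gamma>) = (\<integral>x. monomial ps x \<partial>\<eta>)"
  using assms(6)
proof (induction "length ps" arbitrary: ps rule: less_induct)
  case less
  interpret \<gamma>: prob_space \<gamma> by (rule \<gamma>(1))
  interpret \<eta>: prob_space \<eta> by (rule \<eta>(1))
  show ?case
  proof (cases "ps = []")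
    case True
    then show ?thesis by (simp add: monomial_def[abs_def] \<gamma>.prob_space \<eta>.prob_space)
  next
    case False
    define m where "m = length ps"
    define qs where "qs = sort_key fst ps"
    define xs where "xs = map fst qs"
    \<comment> \<open>The multi-index records how often each coordinate occurs, so
      \<open>aidx i\<close> recovers \<open>xs\<close>. The evaluation points are read off from
      \<open>qs\<close> in the same order, and beyond \<open>m\<close> the value of \<open>z\<close>
      is \<open>undefined\<close>, as \<open>PiE\<close> demands.\<close>
    define i where "i = count_list xs"
    define z where "z = (\<lambda>j\<in>{..<m}. snd (qs ! j))"
    have len: "length xs = m" "length qs = m" by (simp_all add: xs_def qs_def m_def)
    have qs_pts: "set qs \<subseteq> points" using less.prems by (simp add: qs_def)
    then have xs_sub: "set xs \<subseteq> {..<d}" by (auto simp: xs_def points_def)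
    have degm: "deg d i = m"
      unfolding deg_def i_def using sum_count_set[OF xs_sub] len by simp
    have "sorted xs" by (simp add: xs_def qs_def)
    then have a: "aidx i j = fst (qs ! j)" if "j < m" for j
      using aidx_count_list[of xs j] that len by (simp add: i_def xs_def)
    have az: "(aidx i j, z j) = qs ! j" if "j < m" for j
      using a[OF that] that by (simp add: z_def)
    have i0: "\<forall>l\<ge>d. i l = 0"
      using xs_sub by (auto simp: i_def count_list_0_iff)
    have z_car: "z \<in> tens_carrier d X i"
      unfolding tens_carrier_def degm
    proof (rule PiE_I)
      fix j assume j: "j \<in> {..<m}"
      then have "qs ! j \<in> points" using qs_pts len by auto
      then show "z j \<in> topspace (X (aidx i j))"
        using a[of j] j by (auto simp: z_def points_def)
    qed (simp add: z_def)
    define F where "F \<mu> B = (\<integral>x. monomial (map (\<lambda>j. (aidx i j, z j)) (sorted_list_of_set B)) x \<partial>\<mu>)"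
      for \<mu> :: "(nat \<Rightarrow> 'a) measure" and B
    have small: "F \<gamma> B = F \<eta> B" if B: "B \<subset> {..<m}" for B
      unfolding F_def
    proof (rule less.hyps)
      have fin: "finite B" using B finite_subset by blast
      show "length (map (\<lambda>j. (aidx i j, z j)) (sorted_list_of_set B)) < length ps"
        using psubset_card_mono[OF _ B] by (simp add: m_def)
      show "set (map (\<lambda>j. (aidx i j, z j)) (sorted_list_of_set B)) \<subseteq> points"
      proof -
        have "(aidx i j, z j) \<in> points" if "j \<in> B" for j
        proof -
          have "j < m" using that B by auto
          then show ?thesis
            unfolding az[OF \<open>j < m\<close>] using qs_pts nth_mem[of j qs] len by auto
        qed
        then show ?thesis using fin by auto
      qed
    qed
    have full: "F \<mu> {..<m} = (\<integral>x. monomial ps x \<partial>\<mu>)" for \<mu>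
    proof -
      have "map (\<lambda>j. (aidx i j, z j)) (sorted_list_of_set {..<m}) = qs"
        using az len by (intro nth_equalityI) (auto simp: sorted_list_of_set_lessThan_Suc lessThan_atLeast0)
      then show ?thesis by (simp add: F_def qs_def monomial_sort)
    qed
    have m0: "0 < m" using False by (simp add: m_def)
    \<comment> \<open>Positive degree matters here: for \<open>m = 0\<close> the single block would
      be empty, which a partition forbids.\<close>
    have top: "{{..<m}} \<in> partitions m"
      using m0 by (auto simp: partitions_def intro!: partition_on_space)
    have rest: "(\<Sum>\<pi>\<in>partitions m - {{{..<m}}}. cpi \<pi> * (\<Prod>B\<in>\<pi>. F \<gamma> B))
        = (\<Sum>\<pi>\<in>partitions m - {{{..<m}}}. cpi \<pi> * (\<Prod>B\<in>\<pi>. F \<eta> B))"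
    proof (intro sum.cong refl arg_cong2[where f="(*)"] prod.cong small)
      fix \<pi> B assume "\<pi> \<in> partitions m - {{{..<m}}}" "B \<in> \<pi>"
      then show "B \<subset> {..<m}"
        unfolding partitions_def by (intro partition_on_block_psubset[of _ \<pi>]) simp_all
    qed
    have expand: "(\<Sum>\<pi>\<in>partitions m. cpi \<pi> * (\<Prod>B\<in>\<pi>. F \<mu> B))
        = F \<mu> {..<m} + (\<Sum>\<pi>\<in>partitions m - {{{..<m}}}. cpi \<pi> * (\<Prod>B\<in>\<pi>. F \<mu> B))" for \<mu>
      using sum.remove[OF finite_partitions top, of "\<lambda>\<pi>. cpi \<pi> * (\<Prod>B\<in>\<pi>. F \<mu> B)"] by (simp add: cpi_def)
    have "kcumulant d X k i \<gamma> z = kcumulant d X k i \<eta> z"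
      using m0 by (intro cum i0 z_car) (simp add: degm)
    then have "(\<Sum>\<pi>\<in>partitions m. cpi \<pi> * (\<Prod>B\<in>\<pi>. F \<gamma> B)) = (\<Sum>\<pi>\<in>partitions m. cpi \<pi> * (\<Prod>B\<in>\<pi>. F \<eta> B))"
      unfolding kcumulant_eq[OF \<gamma> z_car] kcumulant_eq[OF \<eta> z_car] degm F_def .
    then show ?thesis
      unfolding expand rest full by simp
  qed
qed

text \<open>The two cumulants are the mean embeddings of \<open>U\<close> and \<open>V\<close>,
  which put the coefficients \<open>cpi\<close> on the partition measures. The norm is that of
  \<open>pre_diff U V\<close>, expanded bilinearly; symmetry of the form merges the two mixed sums,
  hence the factor 2.\<close>

lemma cumulant_difference_norm:
  assumes \<gamma>: "prob_space \<gamma>" "sets \<gamma> = sets (joint_space d X)"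
    and \<eta>: "prob_space \<eta>" "sets \<eta> = sets (joint_space d X)"
  defines "f \<equiv> \<lambda>i z. kcumulant d X k i \<gamma> z - kcumulant d X k i \<eta> z"
  shows "in_rkhs (tens_carrier d X i) (ktens d k i) (f i)"
    and "rkhs_norm_sq (tens_carrier d X i) (ktens d k i) (f i)
      = (\<Sum>\<pi>\<in>partitions (deg d i). \<Sum>\<tau>\<in>partitions (deg d i). cpi \<pi> * cpi \<tau> *
           (cross_term d X k i \<gamma> \<pi> \<gamma> \<tau> + cross_term d X k i \<eta> \<pi> \<eta> \<tau> - 2 * cross_term d X k i \<gamma> \<pi> \<eta> \<tau>))"
proof -
  let ?T = "tens_space d X i" and ?K = "ktens d k i" and ?P = "partitions (deg d i)"
  let ?g = "partition_measure d X i \<gamma>" and ?e = "partition_measure d X i \<eta>"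
  obtain C where "bounded_measurable_kernel ?T ?K C"
    by (rule bounded_measurable_ktens, rule that)
  then interpret bounded_measurable_kernel ?T ?K C .
  obtain ls where ls: "set ls = ?P" "distinct ls"
    using finite_distinct_list[OF finite_partitions] by blast
  define U where "U = map (\<lambda>\<pi>. (cpi \<pi>, ?g \<pi>)) ls"
  define V where "V = map (\<lambda>\<pi>. (cpi \<pi>, ?e \<pi>)) ls"
  have g: "?g \<pi> \<in> prob_measures ?T" and e: "?e \<pi> \<in> prob_measures ?T" if "\<pi> \<in> ?P" for \<pi>
    using partition_measure_in_prob_measures[OF \<gamma> that] partition_measure_in_prob_measures[OF \<eta> that] by auto
  have UV: "snd ` set U \<subseteq> prob_measures ?T" "snd ` set V \<subseteq> prob_measures ?T"
    using g e ls(1) by (auto simp: U_def V_def)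
  have sum_ls: "(\<Sum>\<pi>\<leftarrow>ls. h \<pi>) = (\<Sum>\<pi>\<in>?P. h \<pi>)" for h :: "nat set set \<Rightarrow> real"
    using sum_list_distinct_conv_sum_set[OF ls(2)] ls(1) by simp
  have ip: "pre_ip (kmean ?K) (map (\<lambda>\<pi>. (cpi \<pi>, M \<pi>)) ls) (map (\<lambda>\<pi>. (cpi \<pi>, N \<pi>)) ls)
      = (\<Sum>\<pi>\<in>?P. \<Sum>\<tau>\<in>?P. cpi \<pi> * cpi \<tau> * kmean ?K (M \<pi>) (N \<tau>))" for M N
    by (simp add: pre_ip_def o_def sum_ls)
  have fz: "f i z = (\<Sum>(c,\<mu>)\<leftarrow>pre_diff U V. c * (\<integral>x. ?K x z \<partial>\<mu>))" for z
    by (simp add: f_def kcumulant_def pre_diff_def U_def V_def o_def sum_ls sum_negf)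
  have L: "snd ` set (pre_diff U V) \<subseteq> prob_measures ?T"
    using UV by simp
  show "in_rkhs (tens_carrier d X i) ?K (f i)"
    using mean_embedding_in_rkhs(1)[OF L fz] by (simp add: space_tens_space)
  have "rkhs_norm_sq (tens_carrier d X i) ?K (f i) = pre_nsq (kmean ?K) (pre_diff U V)"
    using mean_embedding_in_rkhs(2)[OF L fz] by (simp add: space_tens_space)
  also have "\<dots> = pre_ip (kmean ?K) U U - 2 * pre_ip (kmean ?K) U V + pre_ip (kmean ?K) V V"
    unfolding ms.nsq_diff[OF UV] by (simp add: pre_nsq_eq_ip)
  also have "\<dots> = (\<Sum>\<pi>\<in>?P. \<Sum>\<tau>\<in>?P. cpi \<pi> * cpi \<tau> *
      (kmean ?K (?g \<pi>) (?g \<tau>) + kmean ?K (?e \<pi>) (?e \<tau>) - 2 * kmean ?K (?g \<pi>) (?e \<tau>)))"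
    unfolding U_def V_def ip
    by (simp add: sum_distrib_left sum.distrib[symmetric] sum_subtractf[symmetric] algebra_simps)
  also have "\<dots> = (\<Sum>\<pi>\<in>?P. \<Sum>\<tau>\<in>?P. cpi \<pi> * cpi \<tau> *
      (cross_term d X k i \<gamma> \<pi> \<gamma> \<tau> + cross_term d X k i \<eta> \<pi> \<eta> \<tau> - 2 * cross_term d X k i \<gamma> \<pi> \<eta> \<tau>))"
    by (intro sum.cong refl) (simp add: cross_term_def kmean_eq_pair_integral g e)
  finally show "rkhs_norm_sq (tens_carrier d X i) ?K (f i) = \<dots>" .
qed

end

theorem theorem2:
  fixes d :: nat
    and X :: "nat \<Rightarrow> 'a topology"
    and k :: "nat \<Rightarrow> 'a \<Rightarrow> 'a \<Rightarrow> real"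
    and \<gamma> \<eta> :: "(nat \<Rightarrow> 'a) measure"
  assumes polish: "\<And>j. j < d \<Longrightarrow> Polish (X j)"
    and kernel: "\<And>j. j < d \<Longrightarrow> pd_kernel (topspace (X j)) (k j)"
    and bounded: "\<And>j. j < d \<Longrightarrow> bounded_kernel (topspace (X j)) (k j)"
    and cont: "\<And>j. j < d \<Longrightarrow> continuous_map (prod_topology (X j) (X j)) euclideanreal (\<lambda>(x, y). k j x y)"
    and sep: "\<And>j. j < d \<Longrightarrow> point_separating (topspace (X j)) (k j)"
    and \<gamma>: "prob_space \<gamma>" "sets \<gamma> = sets (joint_space d X)"
    and \<eta>: "prob_space \<eta>" "sets \<eta> = sets (joint_space d X)"
  shows "(\<gamma> = \<eta> \<longleftrightarrow>
            (\<forall>i. (\<forall>l\<ge>d. i l = 0) \<and> 1 \<le> deg d i \<longrightarrow>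
               (\<forall>z\<in>tens_carrier d X i. kcumulant d X k i \<gamma> z = kcumulant d X k i \<eta> z)))
       \<and> (\<forall>i. (\<forall>l\<ge>d. i l = 0) \<and> 1 \<le> deg d i \<longrightarrow>
            in_rkhs (tens_carrier d X i) (ktens d k i) (\<lambda>z. kcumulant d X k i \<gamma> z - kcumulant d X k i \<eta> z)
          \<and> rkhs_norm_sq (tens_carrier d X i) (ktens d k i) (\<lambda>z. kcumulant d X k i \<gamma> z - kcumulant d X k i \<eta> z)
            = (\<Sum>\<pi>\<in>partitions (deg d i). \<Sum>\<tau>\<in>partitions (deg d i). cpi \<pi> * cpi \<tau> *
                 (cross_term d X k i \<gamma> \<pi> \<gamma> \<tau> + cross_term d X k i \<eta> \<pi> \<eta> \<tau> - 2 * cross_term d X k i \<gamma> \<pi> \<eta> \<tau>)))"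
proof -
  interpret kernel_family d X k
    by standard (fact polish kernel bounded cont sep)+
  \<comment> \<open>Only this implication takes an argument; the other one is a
    substitution.\<close>
  have "\<gamma> = \<eta>" if cum: "\<forall>i. (\<forall>l\<ge>d. i l = 0) \<and> 1 \<le> deg d i \<longrightarrow>
      (\<forall>z\<in>tens_carrier d X i. kcumulant d X k i \<gamma> z = kcumulant d X k i \<eta> z)"
  proof (rule moments_determine_measure[OF \<gamma> \<eta>])
    fix ps assume ps: "set ps \<subseteq> points"
    show "(\<integral>x. monomial ps x \<partial>\<gamma>) = (\<integral>x. monomial ps x \<partial>\<eta>)"
      by (rule moments_eq_if_cumulants_eq[OF \<gamma> \<eta> _ ps]) (use cum in blast)
  qed
  then show ?thesis
    using cumulant_difference_norm[OF \<gamma> \<eta>] by blast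
qed

end
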